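(* Let $Q$ be an $\epsilon$-DP-Rec mechanism that uses a random key $U\in\mathcal{U}$ and an input database $X^{T}\in\mathcal{X}^{T}$, where $|\mathcal{X}|=k$, to create an output $Y^{T}\in\mathcal{Y}^{T}$. The following conditions are necessary and sufficient to allow recovery of the input $X^{T}$ from $(U,Y^{T})$: (1) $|\mathcal{U}|\geq |\mathcal{Y}^{T}|\geq |\mathcal{X}^{T}|$. (2) The entropy of the random key must satisfy $$H(U)\geq T\min_{s^{*}\in\{\lceil l\rceil,\lfloor l\rfloor\}}H(U_{\min}^{s^{*}}),$$ where $l=k\,\frac{e^{\epsilon}(\epsilon-1)+1}{(e^{\epsilon}-1)^2}$ and $U_{\min}^{s}$ is a random variable with support size $|\mathcal{X}|=k$ whose distribution has $k-s$ terms equal to $1/t$ and the remaining $s$ terms equal to $e^{\epsilon}/t$, with $t=se^{\epsilon}+k-s$.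
   Context: $H$ denotes Shannon entropy. The random key $U$ is a random variable taking values in a discrete set $\mathcal{U}$. The input is a sequence of $T$ samples $X^{T}=(X^{(1)},\ldots,X^{(T)})$ with $X^{(t)}\in\mathcal{X}$, and the output is $Y^{T}=(Y^{(1)},\ldots,Y^{(T)})\in\mathcal{Y}^{T}=\mathcal{Y}^{(1)}\times\cdots\times\mathcal{Y}^{(T)}$, where $Y^{(t)}\in\mathcal{Y}^{(t)}$ may be a function of $X^{(1)},\ldots,X^{(t)}$ and of the key $U$, and the sets $\mathcal{Y}^{(t)}$ need not coincide for different $t$. Write $Q(\mathbf{y}|\mathbf{x})=\Pr[Y^{T}=\mathbf{y}\mid X^{T}=\mathbf{x}]$. Two databases $\mathbf{x},\mathbf{x}'\in\mathcal{X}^{T}$ are neighboring if they differ in exactly one coordinate. $Q$ is $\epsilon$-DP (differentially private) if $\sup_{\mathbf{y}\in\mathcal{Y}^{T}}Q(\mathbf{y}|\mathbf{x})/Q(\mathbf{y}|\mathbf{x}')\le e^{\epsilon}$ for all neighboring $\mathbf{x},\mathbf{x}'$. $Q$ is $\epsilon$-DP-Rec if it is $\epsilon$-DP and allows the recovery of the input $X^{T}$ from the output $Y^{T}$ and the key $U$. When $\epsilon=0$ the distribution of $U_{\min}^{s}$ is uniform on $k$ values irrespective of $s$.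
   Formalization: In (1) the set of outputs means those of positive probability; sufficiency, false for an arbitrary given key, is stated as achievability: all sizes allowed by (1) occur, all entropies allowed by (2) occur, and the minimal sizes and entropy occur together; the key is independent of the input. *)

theory Defs
  imports "HOL-Probability.Probability" "HOL-Library.Equipollence"
begin

text \<open>Shannon entropy in bits, with values in \<^typ>\<open>ennreal\<close> because a key with infinite
  support may have infinite entropy; the integration-based entropy of
  \<^theory>\<open>HOL-Probability.Information\<close> would be a junk real number for such a key.
  The two notions agree otherwise, see \<open>shannon_entropy_eq_entropy\<close>.\<close>

definition shannon_entropy :: "'a pmf \<Rightarrow> ennreal" where
  "shannon_entropy p =
    (\<integral>\<^sup>+u. ennreal (- (pmf p u * log 2 (pmf p u))) \<partial>count_space UNIV)"

lemma shannon_entropy_eq_entropy: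
  fixes p :: "'a::countable pmf"
  assumes "integrable (count_space UNIV) (\<lambda>u. pmf p u * log 2 (pmf p u))"
  shows "shannon_entropy p
    = ennreal (prob_space.entropy (measure_pmf p) 2 (count_space UNIV) (\<lambda>u. u))"
proof -
  interpret I: information_space "measure_pmf p" 2
    by unfold_locales simp
  interpret C: sigma_finite_measure "count_space (UNIV :: 'a set)"
    by (intro sigma_finite_measure_count_space_countable) auto
  have nonneg: "0 \<le> - (pmf p u * log 2 (pmf p u))" for u
    by (cases "pmf p u = 0") (auto simp: mult_le_0_iff pmf_le_1 less_le)
  have "distr (measure_pmf p) (count_space UNIV) (\<lambda>u. u) = measure_pmf p"
    by (rule distr_id2) simp
  then have "distributed (measure_pmf p) (count_space UNIV) (\<lambda>u. u) (\<lambda>u. ennreal (pmf p u))"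
    by (simp add: distributed_def measure_pmf_eq_density)
  then have "prob_space.entropy (measure_pmf p) 2 (count_space UNIV) (\<lambda>u. u)
      = - (\<integral>u. pmf p u * log 2 (pmf p u) \<partial>count_space UNIV)"
    by (intro I.entropy_distr) auto
  also have "\<dots> = (\<integral>u. - (pmf p u * log 2 (pmf p u)) \<partial>count_space UNIV)"
    by simp
  finally show ?thesis
    unfolding shannon_entropy_def using assms nonneg
    by (subst nn_integral_eq_integral) auto
qed

text \<open>The key is independent of the database, so the conditional law of the output given the
  database \<open>x\<close> is the law of the encoder output for fixed \<open>x\<close> under the key distribution.
  Time is counted from 0: the \<open>t\<close>-th output is computed from the samples
  \<open>x ! 0, \<dots>, x ! t\<close> and the key.\<close>

definition databases :: "'x set \<Rightarrow> nat \<Rightarrow> 'x list set" where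
  "databases X T = {x. set x \<subseteq> X \<and> length x = T}"

definition neighboring :: "'x list \<Rightarrow> 'x list \<Rightarrow> bool" where
  "neighboring x x' \<longleftrightarrow> length x = length x' \<and> card {t. t < length x \<and> x ! t \<noteq> x' ! t} = 1"

definition mech_output :: "(nat \<Rightarrow> 'x list \<Rightarrow> 'u \<Rightarrow> 'y) \<Rightarrow> 'x list \<Rightarrow> 'u \<Rightarrow> 'y list" where
  "mech_output enc x u = map (\<lambda>t. enc t (take (Suc t) x) u) [0..<length x]"

definition mech_prob :: "'u pmf \<Rightarrow> (nat \<Rightarrow> 'x list \<Rightarrow> 'u \<Rightarrow> 'y) \<Rightarrow> 'y list \<Rightarrow> 'x list \<Rightarrow> real" where
  "mech_prob U enc y x = pmf (map_pmf (mech_output enc x) U) y"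

definition output_space :: "nat \<Rightarrow> (nat \<Rightarrow> 'y set) \<Rightarrow> 'y list set" where
  "output_space T Y = listset (map Y [0..<T])"

text \<open>The quotients are formed in \<^typ>\<open>ennreal\<close>, where \<open>a / 0 = \<infinity>\<close> for \<open>a > 0\<close> and
  \<open>0 / 0 = 0\<close>: an output that has probability zero for one of two neighboring databases must have
  probability zero for both.\<close>

definition differentially_private ::
    "real \<Rightarrow> 'x set \<Rightarrow> nat \<Rightarrow> 'u pmf \<Rightarrow> (nat \<Rightarrow> 'y set) \<Rightarrow> (nat \<Rightarrow> 'x list \<Rightarrow> 'u \<Rightarrow> 'y) \<Rightarrow> bool" where
  "differentially_private \<epsilon> X T U Y enc \<longleftrightarrow>
    (\<forall>x\<in>databases X T. \<forall>x'\<in>databases X T. neighboring x x' \<longrightarrow>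
      (SUP y\<in>output_space T Y. ennreal (mech_prob U enc y x) / ennreal (mech_prob U enc y x'))
        \<le> ennreal (exp \<epsilon>))"

definition recoverable ::
    "'x set \<Rightarrow> nat \<Rightarrow> 'u pmf \<Rightarrow> (nat \<Rightarrow> 'x list \<Rightarrow> 'u \<Rightarrow> 'y) \<Rightarrow> bool" where
  "recoverable X T U enc \<longleftrightarrow>
    (\<exists>dec. \<forall>x\<in>databases X T. \<forall>u\<in>set_pmf U. dec u (mech_output enc x u) = x)"

definition DP_Rec ::
    "real \<Rightarrow> 'x set \<Rightarrow> nat \<Rightarrow> 'u pmf \<Rightarrow> (nat \<Rightarrow> 'y set) \<Rightarrow> (nat \<Rightarrow> 'x list \<Rightarrow> 'u \<Rightarrow> 'y) \<Rightarrow> bool" where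
  "DP_Rec \<epsilon> X T U Y enc \<longleftrightarrow>
    (\<forall>x\<in>databases X T. \<forall>u\<in>set_pmf U. mech_output enc x u \<in> output_space T Y) \<and>
    differentially_private \<epsilon> X T U Y enc \<and>
    recoverable X T U enc"

text \<open>Outputs of positive probability. Bounds on the number of outputs have to refer to these:
  since the components of the output may depend on each other, the full product can be larger
  than the set of keys. For example, with two binary samples and four equiprobable keys
  \<open>(u\<^sub>1, u\<^sub>2)\<close>, the outputs \<open>y\<^sub>1 = x\<^sub>1 + u\<^sub>1\<close> and \<open>y\<^sub>2 = (y\<^sub>1, x\<^sub>2 + u\<^sub>2)\<close> (additions modulo 2)
  are perfectly private and decodable, but live in a product with eight elements.\<close>

definition attained_outputs ::
    "'x set \<Rightarrow> nat \<Rightarrow> 'u pmf \<Rightarrow> (nat \<Rightarrow> 'y set) \<Rightarrow> (nat \<Rightarrow> 'x list \<Rightarrow> 'u \<Rightarrow> 'y) \<Rightarrow> 'y list set" where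
  "attained_outputs X T U Y enc = {y \<in> output_space T Y. \<exists>x\<in>databases X T. 0 < mech_prob U enc y x}"

text \<open>The first \<open>s\<close> of the \<open>k\<close> values \<open>0, \<dots>, k - 1\<close> carry the larger mass. The definition is
  meaningful for \<open>s \<le> k\<close> and \<open>0 < k\<close> only, see \<open>pmf_U_min\<close>.\<close>

definition U_min :: "nat \<Rightarrow> real \<Rightarrow> nat \<Rightarrow> nat pmf" where
  "U_min k \<epsilon> s = (let t = real s * exp \<epsilon> + real k - real s in
    embed_pmf (\<lambda>i. if i < s then exp \<epsilon> / t else if i < k then 1 / t else 0))"

lemma U_min_norm_pos:
  assumes "s \<le> k" "0 < k"
  shows "0 < real s * exp \<epsilon> + real k - real s"
proof (cases "s = 0")
  case False
  then have "0 < real s * exp \<epsilon>" by simp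
  with assms show ?thesis by (simp add: add_pos_nonneg add_diff_eq[symmetric])
qed (use assms in simp)

lemma pmf_U_min:
  fixes k s i :: nat and \<epsilon> :: real
  assumes "s \<le> k" "0 < k"
  defines "t \<equiv> real s * exp \<epsilon> + real k - real s"
  shows "pmf (U_min k \<epsilon> s) i = (if i < s then exp \<epsilon> / t else if i < k then 1 / t else 0)"
proof -
  let ?f = "\<lambda>i. if i < s then exp \<epsilon> / t else if i < k then 1 / t else 0"
  have t: "0 < t"
    unfolding t_def using assms(1,2) by (rule U_min_norm_pos)
  then have nonneg: "0 \<le> ?f i" for i by simp
  have split: "{..<k} = {..<s} \<union> {s..<k}" using assms(1) by auto
  have "(\<Sum>i<k. ?f i) = (\<Sum>i<s. exp \<epsilon> / t) + (\<Sum>i=s..<k. 1 / t)"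
    unfolding split by (subst sum.union_disjoint) (auto intro!: arg_cong2[of _ _ _ _ "(+)"] sum.cong)
  also have "\<dots> = t / t"
    using assms(1) by (simp add: t_def of_nat_diff flip: add_divide_distrib)
  finally have sum: "(\<Sum>i<k. ?f i) = 1" using t by simp
  have "(\<integral>\<^sup>+i. ennreal (?f i) \<partial>count_space UNIV) = (\<Sum>i<k. ennreal (?f i))"
    using assms(1) by (intro nn_integral_count_space') auto
  also have "\<dots> = 1"
    using nonneg sum by (subst sum_ennreal) auto
  finally show ?thesis
    unfolding U_min_def Let_def t_def[symmetric] using nonneg by (subst pmf_embed_pmf) auto
qed

text \<open>For \<open>\<epsilon> = 0\<close> the quotient below is \<open>0 / 0 = 0\<close>. This is harmless, since \<open>U_min k 0 s\<close> is uniform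
  for every \<open>s \<le> k\<close>.\<close>

definition s_opt :: "nat \<Rightarrow> real \<Rightarrow> real" where
  "s_opt k \<epsilon> = real k * ((exp \<epsilon> * (\<epsilon> - 1) + 1) / (exp \<epsilon> - 1)\<^sup>2)"

end

theory Submission
  imports Defs "HOL-Real_Asymp.Real_Asymp"
begin

text \<open>Necessity. For a fixed database \<open>x\<close> the output is a function of the key, so \<open>H(U) \<ge> H(Q(\<cdot>|x))\<close>;
  average this over all databases. Recovery makes the sets of keys that send different databases to
  the same output \<open>y\<close> disjoint, so \<open>S y = (\<Sum>x. Q(y|x)) \<le> 1\<close>, and the average is at least the mean,
  with weights proportional to \<open>S y\<close>, of the entropies of the laws \<open>Q(y|x) / S y\<close> on databases. By the
  chain rule each of these is a sum of \<open>T\<close> entropies of laws on \<open>X\<close> whose ratios are bounded by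
  \<open>exp \<epsilon>\<close>. In homogeneous form the entropy is concave in each single weight, so it is least when all
  weights are extremal, which are the laws of \<open>U_min k \<epsilon> s\<close>; as a function of real \<open>s\<close> their entropy
  decreases up to \<open>s_opt k \<epsilon>\<close> and increases afterwards.

  Sufficiency. Independent keys distributed as \<open>U_min k \<epsilon> s\<close>, added to the samples modulo \<open>k\<close>, attain the
  minimum. An additional key component that the encoder ignores yields every larger entropy.
  For prescribed numbers of keys and outputs, use a one-time pad on the set of all databases, embedded
  in blocks of outputs, and split its keys.\<close>

section \<open>Laws with bounded ratios\<close>

text \<open>Coordinates move to an endpoint of the interval one after another, never increasing
  \<open>f\<close>. The hypothesis \<open>step\<close> covers the whole box because it is applied at
  points where earlier coordinates have already moved.\<close>

lemma box_vertex_minimum: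
  fixes f :: "('a \<Rightarrow> real) \<Rightarrow> real" and a b :: real
  assumes "finite I" and "a \<le> b" and "\<And>i. i \<in> I \<Longrightarrow> v i \<in> {a..b}"
    and step: "\<And>w i. i \<in> I \<Longrightarrow> (\<And>j. j \<in> I \<Longrightarrow> w j \<in> {a..b}) \<Longrightarrow>
      min (f (w(i := a))) (f (w(i := b))) \<le> f w"
  shows "\<exists>w. (\<forall>i\<in>I. w i \<in> {a, b}) \<and> f w \<le> f v"
proof -
  have "\<exists>w. (\<forall>i\<in>J. w i \<in> {a, b}) \<and> (\<forall>i\<in>I. w i \<in> {a..b}) \<and> f w \<le> f v" if "J \<subseteq> I" for J
    using finite_subset[OF that \<open>finite I\<close>] that
  proof (induction J rule: finite_induct)
    case empty
    then show ?case using assms(3) by blast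
  next
    case (insert i J)
    then obtain w where w: "\<forall>i\<in>J. w i \<in> {a, b}" "\<forall>i\<in>I. w i \<in> {a..b}" "f w \<le> f v"
      by auto
    have "i \<in> I" using insert by simp
    then have "min (f (w(i := a))) (f (w(i := b))) \<le> f w"
      using step w(2) by blast
    then obtain c where c: "c \<in> {a, b}" "f (w(i := c)) \<le> f w"
      by (auto simp: min_def split: if_splits)
    show ?case
    proof (intro exI[of _ "w(i := c)"] conjI)
      show "f (w(i := c)) \<le> f v" using c(2) w(3) by linarith
    qed (use w c \<open>a \<le> b\<close> in auto)
  qed
  from this[of I] show ?thesis by auto
qed

lemma concave_on_ge_min:
  fixes f :: "real \<Rightarrow> real"
  assumes "concave_on {a..b} f" and "x \<in> {a..b}"
  shows "min (f a) (f b) \<le> f x"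
proof (cases "a = b")
  case False
  with assms(2) have "a < b" by auto
  define t where "t = (x - a) / (b - a)"
  have t: "0 \<le> t" "t \<le> 1" "x = (1 - t) * a + t * b"
    using assms(2) \<open>a < b\<close> by (auto simp: t_def divide_simps) (simp add: algebra_simps)
  have "(1 - t) * f a + t * f b \<le> f x"
    using assms(1) t \<open>a < b\<close> concave_onD[OF assms(1), of t a b] by simp
  moreover have "(1 - t) * min (f a) (f b) + t * min (f a) (f b) \<le> (1 - t) * f a + t * f b"
    using t by (intro add_mono mult_left_mono) auto
  ultimately show ?thesis by (simp add: algebra_simps)
qed (use assms in auto)

text \<open>Up to terms free of \<open>z\<close>, this is the homogeneous entropy minus
  \<open>h\<close> times the total weight, seen as a function of one weight \<open>z\<close> while
  the other weights sum to \<open>R\<close>.\<close>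

lemma concave_on_entropy_coordinate:
  fixes R h a b :: real
  assumes "0 < a" and "0 \<le> R"
  shows "concave_on {a..b} (\<lambda>z. (R + z) * ln (R + z) - z * ln z - h * z)"
proof (rule f''_le0_imp_concave)
  fix z assume "z \<in> {a..b}"
  with assms have z: "0 < z" "0 < R + z" by auto
  show "((\<lambda>z. (R + z) * ln (R + z) - z * ln z - h * z) has_real_derivative
      (ln (R + z) - ln z - h)) (at z)"
    using z by (auto intro!: derivative_eq_intros)
  show "((\<lambda>z. ln (R + z) - ln z - h) has_real_derivative (1 / (R + z) - 1 / z)) (at z)"
    using z by (auto intro!: derivative_eq_intros simp: field_simps)
  show "1 / (R + z) - 1 / z \<le> 0"
    using z assms by (auto intro!: divide_left_mono)
qed simp

text \<open>The entropy of \<open>U_min k \<epsilon> s\<close> in nats, extended to real \<open>s\<close>.\<close>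

definition two_level_entropy :: "nat \<Rightarrow> real \<Rightarrow> real \<Rightarrow> real" where
  "two_level_entropy k \<epsilon> s =
    (let t = s * exp \<epsilon> + real k - s in ln t - s * exp \<epsilon> * \<epsilon> / t)"

text \<open>The formula for \<open>s_opt\<close> originates here: over the square of
  \<open>t\<close>, the numerator of the derivative is affine in \<open>s\<close>, with root
  \<open>s_opt k \<epsilon>\<close>.\<close>

lemma two_level_entropy_deriv:
  assumes "0 < k" "0 < \<epsilon>" "0 \<le> s"
  defines "t \<equiv> s * exp \<epsilon> + real k - s"
  shows "(two_level_entropy k \<epsilon> has_real_derivative
    (exp \<epsilon> - 1)\<^sup>2 * (s - s_opt k \<epsilon>) / t\<^sup>2) (at s)"
proof -
  have t: "0 < t"
  proof -
    have "0 \<le> s * (exp \<epsilon> - 1)" using assms by simp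
    then show ?thesis using assms by (simp add: algebra_simps)
  qed
  have E: "exp \<epsilon> - 1 \<noteq> 0" using assms by simp
  have "((\<lambda>s. ln (s * exp \<epsilon> + real k - s) - s * exp \<epsilon> * \<epsilon> / (s * exp \<epsilon> + real k - s))
      has_real_derivative
      (exp \<epsilon> - 1) / t - (exp \<epsilon> * \<epsilon> * t - s * exp \<epsilon> * \<epsilon> * (exp \<epsilon> - 1)) / (t * t)) (at s)"
    using t unfolding t_def
    by (auto intro!: derivative_eq_intros simp del: times_divide_eq_right)
  moreover have "(exp \<epsilon> - 1) / t - (exp \<epsilon> * \<epsilon> * t - s * exp \<epsilon> * \<epsilon> * (exp \<epsilon> - 1)) / (t * t)
      = ((exp \<epsilon> - 1) * t - exp \<epsilon> * \<epsilon> * t + s * exp \<epsilon> * \<epsilon> * (exp \<epsilon> - 1)) / t\<^sup>2"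
    using t by (simp add: field_simps power2_eq_square)
  moreover have "(exp \<epsilon> - 1) * t - exp \<epsilon> * \<epsilon> * t + s * exp \<epsilon> * \<epsilon> * (exp \<epsilon> - 1)
      = (exp \<epsilon> - 1)\<^sup>2 * (s - s_opt k \<epsilon>)"
  proof -
    have "(exp \<epsilon> - 1)\<^sup>2 * s_opt k \<epsilon> = real k * (exp \<epsilon> * (\<epsilon> - 1) + 1)"
      using E by (simp add: s_opt_def)
    then have "(exp \<epsilon> - 1)\<^sup>2 * (s - s_opt k \<epsilon>)
        = (exp \<epsilon> - 1)\<^sup>2 * s - real k * (exp \<epsilon> * (\<epsilon> - 1) + 1)"
      by (simp add: right_diff_distrib)
    then show ?thesis by (simp add: t_def algebra_simps power2_eq_square)
  qed
  ultimately show ?thesis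
    unfolding two_level_entropy_def Let_def by simp
qed

text \<open>Both bounds come from \<open>1 + x \<le> exp x\<close>, at
  \<open>x = - \<epsilon>\<close> and at \<open>x = \<epsilon>\<close>. They ensure that rounding
  gives values of \<open>s\<close> for which \<open>U_min\<close> is meaningful.\<close>

lemma s_opt_bounds:
  assumes "0 \<le> \<epsilon>"
  shows "0 \<le> s_opt k \<epsilon>" "s_opt k \<epsilon> \<le> real k"
proof -
  have "1 - \<epsilon> \<le> exp (- \<epsilon>)" using exp_ge_add_one_self[of "- \<epsilon>"] by simp
  then have "exp \<epsilon> * (1 - \<epsilon>) \<le> exp \<epsilon> * exp (- \<epsilon>)" by (intro mult_left_mono) auto
  then have num: "0 \<le> exp \<epsilon> * (\<epsilon> - 1) + 1"
    by (simp add: exp_minus_inverse algebra_simps)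
  then show "0 \<le> s_opt k \<epsilon>" by (simp add: s_opt_def)
  have "0 \<le> exp \<epsilon> * (exp \<epsilon> - 1 - \<epsilon>)"
    using exp_ge_add_one_self[of \<epsilon>]
    by (intro mult_nonneg_nonneg) (simp_all add: algebra_simps)
  then have "exp \<epsilon> * (\<epsilon> - 1) + 1 \<le> (exp \<epsilon> - 1)\<^sup>2"
    by (simp add: power2_eq_square algebra_simps)
  then have "(exp \<epsilon> * (\<epsilon> - 1) + 1) / (exp \<epsilon> - 1)\<^sup>2 \<le> 1"
    by (simp add: divide_le_eq_1)
  then show "s_opt k \<epsilon> \<le> real k"
    unfolding s_opt_def by (intro mult_left_le) auto
qed

text \<open>The sign of the derivative changes at \<open>l\<close>, and every integer lies at or
  below the floor or at or above the ceiling of \<open>l\<close>. For \<open>\<epsilon> = 0\<close>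
  the entropy is constant in \<open>s\<close>.\<close>

lemma two_level_entropy_integer_minimum:
  assumes "0 < k" "0 \<le> \<epsilon>"
  defines "l \<equiv> s_opt k \<epsilon>"
  shows "min (two_level_entropy k \<epsilon> (nat \<lceil>l\<rceil>)) (two_level_entropy k \<epsilon> (nat \<lfloor>l\<rfloor>))
    \<le> two_level_entropy k \<epsilon> (real s)"
proof (cases "\<epsilon> = 0")
  case True
  then show ?thesis by (simp add: two_level_entropy_def)
next
  case False
  then have "0 < \<epsilon>" using assms by simp
  note deriv = two_level_entropy_deriv[OF \<open>0 < k\<close> this]
  have l: "0 \<le> l" unfolding l_def using s_opt_bounds assms by simp
  have "int s \<le> \<lfloor>l\<rfloor> \<or> \<lceil>l\<rceil> \<le> int s" using ceiling_diff_floor_le_1[of l] by linarith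
  then consider "real s \<le> real_of_int \<lfloor>l\<rfloor>" | "real_of_int \<lceil>l\<rceil> \<le> real s" by linarith
  then show ?thesis
  proof cases
    case 1
    have "two_level_entropy k \<epsilon> (real_of_int \<lfloor>l\<rfloor>) \<le> two_level_entropy k \<epsilon> (real s)"
    proof (rule DERIV_nonpos_imp_nonincreasing[OF 1])
      fix x assume x: "real s \<le> x" "x \<le> real_of_int \<lfloor>l\<rfloor>"
      then have x: "0 \<le> x" "x \<le> l" by linarith+
      show "\<exists>y. DERIV (two_level_entropy k \<epsilon>) x :> y \<and> y \<le> 0"
        by (intro exI conjI, rule deriv[OF x(1)])
           (use x in \<open>auto simp: l_def intro!: divide_nonpos_nonneg mult_nonneg_nonpos\<close>)
    qed
    then show ?thesis using l by (simp add: min_le_iff_disj)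
  next
    case 2
    have "two_level_entropy k \<epsilon> (real_of_int \<lceil>l\<rceil>) \<le> two_level_entropy k \<epsilon> (real s)"
    proof (rule DERIV_nonneg_imp_nondecreasing[OF 2])
      fix x assume x: "real_of_int \<lceil>l\<rceil> \<le> x" "x \<le> real s"
      then have x: "0 \<le> x" "l \<le> x" using l by linarith+
      show "\<exists>y. DERIV (two_level_entropy k \<epsilon>) x :> y \<and> 0 \<le> y"
        by (intro exI conjI, rule deriv[OF x(1)]) (use x in \<open>auto simp: l_def\<close>)
    qed
    then show ?thesis using l by (simp add: min_le_iff_disj)
  qed
qed

text \<open>Both sides are homogeneous in \<open>w\<close>; the right one is the total weight times
  the entropy in nats of the normalized law. Without normalization one weight can vary while the
  others stay fixed, which permits the reduction to vertices of a box.\<close>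

lemma entropy_bounded_ratio:
  fixes w :: "'a \<Rightarrow> real"
  assumes X: "finite X" "X \<noteq> {}" and "0 \<le> \<epsilon>"
    and pos: "\<And>x. x \<in> X \<Longrightarrow> 0 < w x"
    and ratio: "\<And>x x'. x \<in> X \<Longrightarrow> x' \<in> X \<Longrightarrow> w x \<le> exp \<epsilon> * w x'"
    and h: "\<And>s. s \<le> card X \<Longrightarrow> h \<le> two_level_entropy (card X) \<epsilon> (real s)"
  shows "h * sum w X \<le> (\<Sum>x\<in>X. w x * ln (sum w X / w x))"
proof -
  \<comment> \<open>\<open>G\<close> is the right side minus the left side, with the logarithm of
    the quotient expanded.\<close>
  define G where "G v = sum v X * ln (sum v X) - (\<Sum>x\<in>X. v x * ln (v x)) - h * sum v X"
    for v :: "'a \<Rightarrow> real"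
  \<comment> \<open>With the least weight as lower end, the ratio bound places all weights in
    \<open>{a..exp \<epsilon> * a}\<close>.\<close>
  define a where "a = Min (w ` X)"
  define b where "b = exp \<epsilon> * a"
  have "a \<in> w ` X" unfolding a_def using X by (intro Min_in) auto
  then obtain x0 where x0: "x0 \<in> X" "a = w x0" by auto
  then have a: "0 < a" using pos by simp
  have "1 * a \<le> exp \<epsilon> * a" using a \<open>0 \<le> \<epsilon>\<close> by (intro mult_right_mono) auto
  then have ab: "a \<le> b" by (simp add: b_def)
  have w: "w x \<in> {a..b}" if "x \<in> X" for x
    using that X ratio[OF that x0(1)] x0(2) Min_le[of "w ` X" "w x"] by (auto simp: a_def b_def)
  have "\<exists>v. (\<forall>i\<in>X. v i \<in> {a, b}) \<and> G v \<le> G w"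
  proof (rule box_vertex_minimum[OF X(1) ab w])
    fix v i assume i: "i \<in> X" and v: "\<And>j. j \<in> X \<Longrightarrow> v j \<in> {a..b}"
    define R where "R = sum v (X - {i})"
    define L where "L = (\<Sum>x\<in>X - {i}. v x * ln (v x))"
    have "0 \<le> R" unfolding R_def using v a by (intro sum_nonneg) force
    have G: "G (v(i := z)) = (R + z) * ln (R + z) - z * ln z - h * z - L - h * R" for z
    proof -
      have "sum (v(i := z)) X = R + z"
        using i X unfolding R_def by (subst sum.remove[of _ i]) (auto intro!: sum.cong)
      moreover have "(\<Sum>x\<in>X. (v(i := z)) x * ln ((v(i := z)) x)) = L + z * ln z"
        using i X unfolding L_def by (subst sum.remove[of _ i]) (auto intro!: sum.cong)
      ultimately show ?thesis unfolding G_def by (simp add: algebra_simps)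
    qed
    have "G v = G (v(i := v i))" by simp
    then show "min (G (v(i := a))) (G (v(i := b))) \<le> G v"
      using concave_on_ge_min[OF concave_on_entropy_coordinate[OF a \<open>0 \<le> R\<close>, of b h] v[OF i]]
      by (simp only: G)
  qed
  then obtain v where v: "\<And>i. i \<in> X \<Longrightarrow> v i \<in> {a, b}" and Gv: "G v \<le> G w" by blast
  have "0 \<le> G v"
  proof -
    \<comment> \<open>Defining \<open>S\<close> by \<open>v x \<noteq> a\<close> keeps the count
      consistent when \<open>a = b\<close>: then \<open>S\<close> is empty.\<close>
    define S where "S = {x\<in>X. v x \<noteq> a}"
    define k where "k = card X"
    define t where "t = real (card S) * exp \<epsilon> + real k - real (card S)"
    have S: "S \<subseteq> X" "finite S" using X by (auto simp: S_def)
    then have sk: "card S \<le> k" unfolding k_def using X by (intro card_mono) auto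
    have "0 < k" using X by (auto simp: k_def card_gt_0_iff)
    have t: "0 < t" unfolding t_def using U_min_norm_pos[OF sk \<open>0 < k\<close>] .
    have split: "(\<Sum>x\<in>X. f (v x)) = real (card S) * f b + (real k - real (card S)) * f a"
      for f :: "real \<Rightarrow> real"
    proof -
      have "(\<Sum>x\<in>X. f (v x)) = (\<Sum>x\<in>S. f (v x)) + (\<Sum>x\<in>X - S. f (v x))"
        using S X by (metis add.commute sum.subset_diff)
      also have "(\<Sum>x\<in>S. f (v x)) = (\<Sum>x\<in>S. f b)"
        using v by (intro sum.cong) (auto simp: S_def)
      also have "(\<Sum>x\<in>X - S. f (v x)) = (\<Sum>x\<in>X - S. f a)"
        by (intro sum.cong) (auto simp: S_def)
      finally show ?thesis
        using S X sk by (simp add: card_Diff_subset k_def of_nat_diff)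
    qed
    have sum_v: "sum v X = a * t"
      using split[of "\<lambda>z. z"] by (simp add: b_def t_def algebra_simps)
    have lnb: "ln b = \<epsilon> + ln a" using a by (simp add: b_def ln_mult)
    have ent: "(\<Sum>x\<in>X. v x * ln (v x)) = a * t * ln a + real (card S) * b * \<epsilon>"
      using split[of "\<lambda>z. z * ln z"] lnb by (simp add: b_def t_def algebra_simps)
    \<comment> \<open>The vertex \<open>v\<close> is \<open>a\<close> times a vector with
      \<open>card S\<close> entries \<open>exp \<epsilon>\<close> and the rest 1, that is, a
      multiple of the law of \<open>U_min k \<epsilon> (card S)\<close>.\<close>
    have "G v = a * t * (ln t - real (card S) * exp \<epsilon> * \<epsilon> / t - h)"
      unfolding G_def sum_v ent using a t by (simp add: ln_mult b_def field_simps)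
    also have "\<dots> = a * t * (two_level_entropy k \<epsilon> (card S) - h)"
      by (simp add: two_level_entropy_def Let_def t_def)
    also have "0 \<le> \<dots>"
      using a t h[of "card S"] sk by (intro mult_nonneg_nonneg) (auto simp: k_def)
    finally show ?thesis .
  qed
  with Gv have "0 \<le> G w" by simp
  moreover have W: "0 < sum w X" using X pos by (intro sum_pos) auto
  have "(\<Sum>x\<in>X. w x * ln (sum w X / w x)) = (\<Sum>x\<in>X. w x * ln (sum w X) - w x * ln (w x))"
    using pos W by (intro sum.cong) (auto simp: ln_div right_diff_distrib)
  then have "(\<Sum>x\<in>X. w x * ln (sum w X / w x)) = sum w X * ln (sum w X) - (\<Sum>x\<in>X. w x * ln (w x))"
    by (simp add: sum_subtractf sum_distrib_right)
  ultimately show ?thesis by (simp add: G_def)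
qed

section \<open>Databases and neighbors by recursion on the number of samples\<close>

lemma databases_0: "databases X 0 = {[]}"
  by (auto simp: databases_def)

lemma databases_Suc: "databases X (Suc n) = (\<lambda>(x, xs). x # xs) ` (X \<times> databases X n)"
  by (auto simp: databases_def length_Suc_conv image_iff)

lemma finite_databases: "finite X \<Longrightarrow> finite (databases X n)"
  unfolding databases_def by (rule finite_lists_length_eq)

lemma card_databases: "finite X \<Longrightarrow> card (databases X n) = card X ^ n"
  unfolding databases_def by (rule card_lists_length_eq)

lemma databases_nonempty: "X \<noteq> {} \<Longrightarrow> databases X n \<noteq> {}"
  by (induction n) (auto simp: databases_0 databases_Suc)

lemma sum_databases_Suc:
  "(\<Sum>l\<in>databases X (Suc n). f l) = (\<Sum>x\<in>X. \<Sum>xs\<in>databases X n. f (x # xs))"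
proof -
  have "inj_on (\<lambda>(x, xs). x # xs) (X \<times> databases X n)" by (auto simp: inj_on_def)
  then show ?thesis
    unfolding databases_Suc
    by (subst sum.reindex) (simp_all add: sum.cartesian_product case_prod_unfold o_def)
qed

text \<open>Positions in the tail are shifted by one; a difference at the head uses up the single
  permitted difference.\<close>

lemma neighboring_Cons:
  "neighboring (a # xs) (b # ys) \<longleftrightarrow> (if a = b then neighboring xs ys else xs = ys)"
proof (cases "length xs = length ys")
  case True
  let ?D = "{t. t < length xs \<and> xs ! t \<noteq> ys ! t}"
  have "{t. t < length (a # xs) \<and> (a # xs) ! t \<noteq> (b # ys) ! t} = (if a = b then {} else {0}) \<union> Suc ` ?D"
  proof (rule set_eqI)
    fix t
    show "t \<in> {t. t < length (a # xs) \<and> (a # xs) ! t \<noteq> (b # ys) ! t} \<longleftrightarrow>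
        t \<in> (if a = b then {} else {0}) \<union> Suc ` ?D"
      by (cases t) auto
  qed
  moreover have "card ((if a = b then {} else {0}) \<union> Suc ` ?D) = (if a = b then 0 else 1) + card ?D"
    by (subst card_Un_disjoint) (auto simp: card_image)
  moreover have "?D = {} \<longleftrightarrow> xs = ys"
    using True by (auto simp: list_eq_iff_nth_eq)
  moreover have "finite ?D" by simp
  ultimately show ?thesis
    using True unfolding neighboring_def by (cases "a = b") (auto simp del: Collect_empty_eq)
qed (auto simp: neighboring_def)

text \<open>Any two databases are joined by a chain of neighboring ones: change the head first, then
  the tail below the new head.\<close>

lemma databases_neighboring_induct:
  assumes "\<And>x x'. x \<in> databases X n \<Longrightarrow> x' \<in> databases X n \<Longrightarrow> neighboring x x' \<Longrightarrow> P x \<Longrightarrow> P x'"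
    and "x \<in> databases X n" "x' \<in> databases X n" "P x"
  shows "P x'"
  using assms
proof (induction n arbitrary: x x' P)
  case (Suc n)
  obtain a xs b ys where eq: "x = a # xs" "x' = b # ys"
    and mem: "a \<in> X" "b \<in> X" "xs \<in> databases X n" "ys \<in> databases X n"
    using Suc.prems(2,3) by (auto simp: databases_Suc)
  have "P (b # xs)"
  proof (cases "a = b")
    case False
    then show ?thesis
      using Suc.prems(1)[of "a # xs" "b # xs"] Suc.prems(4) mem
      by (auto simp: eq databases_Suc neighboring_Cons)
  qed (use Suc.prems(4) eq in simp)
  moreover have "P (b # zs')" if "zs \<in> databases X n" "zs' \<in> databases X n" "neighboring zs zs'" "P (b # zs)" for zs zs'
    using Suc.prems(1)[of "b # zs" "b # zs'"] that mem
    by (auto simp: databases_Suc neighboring_Cons)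
  ultimately show ?case
    unfolding eq using Suc.IH[of "\<lambda>zs. P (b # zs)" xs ys] mem by blast
qed (simp add: databases_0)

text \<open>The chain rule for the entropy of the law on databases proportional to \<open>w\<close>, in homogeneous
  form: the marginal law of the first sample and the conditional laws of the remaining ones inherit
  the bound on the ratios.\<close>

lemma entropy_databases_bounded_ratio:
  fixes w :: "'x list \<Rightarrow> real"
  assumes X: "finite X" "X \<noteq> {}" and "0 \<le> \<epsilon>"
    and h: "\<And>s. s \<le> card X \<Longrightarrow> h \<le> two_level_entropy (card X) \<epsilon> (real s)"
    and "\<And>x. x \<in> databases X n \<Longrightarrow> 0 < w x"
    and "\<And>x x'. x \<in> databases X n \<Longrightarrow> x' \<in> databases X n \<Longrightarrow> neighboring x x' \<Longrightarrow>
      w x \<le> exp \<epsilon> * w x'"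
  shows "real n * h * sum w (databases X n)
    \<le> (\<Sum>x\<in>databases X n. w x * ln (sum w (databases X n) / w x))"
  using assms(5,6)
proof (induction n arbitrary: w)
  case 0
  then show ?case by (simp add: databases_0)
next
  case (Suc n)
  let ?D = "databases X n"
  \<comment> \<open>\<open>v\<close> is the unnormalized marginal law of the first sample.\<close>
  define v where "v x = (\<Sum>xs\<in>?D. w (x # xs))" for x
  have fin: "finite ?D" "?D \<noteq> {}"
    using X finite_databases databases_nonempty by blast+
  have wpos: "0 < w (x # xs)" if "x \<in> X" "xs \<in> ?D" for x xs
    using Suc.prems(1) that by (auto simp: databases_Suc)
  have vpos: "0 < v x" if "x \<in> X" for x
    unfolding v_def using fin wpos that by (intro sum_pos) auto
  \<comment> \<open>For different heads, \<open>x # xs\<close> and \<open>x' # xs\<close> are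
    neighbors, so the bound holds term by term. Equal heads are treated apart, since a database is
    not its own neighbor.\<close>
  have vratio: "v x \<le> exp \<epsilon> * v x'" if "x \<in> X" "x' \<in> X" for x x'
  proof (cases "x = x'")
    case True
    have "1 * v x \<le> exp \<epsilon> * v x"
      using \<open>0 \<le> \<epsilon>\<close> vpos[OF that(1)] by (intro mult_right_mono) auto
    with True show ?thesis by simp
  next
    case False
    show ?thesis
      unfolding v_def sum_distrib_left using that False
      by (intro sum_mono Suc.prems(2)) (auto simp: databases_Suc neighboring_Cons)
  qed
  define W where "W = sum v X"
  have W: "0 < W" unfolding W_def using X vpos by (intro sum_pos) auto
  have W_eq: "sum w (databases X (Suc n)) = W"
    by (simp add: W_def v_def sum_databases_Suc)
  \<comment> \<open>For fixed head \<open>x\<close>, the weights \<open>w (x # xs)\<close> form the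
    unnormalized conditional law of the tail, with total \<open>v x\<close>.\<close>
  have tail: "real n * h * v x \<le> (\<Sum>xs\<in>?D. w (x # xs) * ln (v x / w (x # xs)))" if "x \<in> X" for x
    unfolding v_def
  proof (rule Suc.IH)
    show "0 < w (x # xs)" if "xs \<in> ?D" for xs using wpos \<open>x \<in> X\<close> that by blast
    show "w (x # xs) \<le> exp \<epsilon> * w (x # xs')"
      if "xs \<in> ?D" "xs' \<in> ?D" "neighboring xs xs'" for xs xs'
      using that \<open>x \<in> X\<close> by (intro Suc.prems(2)) (auto simp: databases_Suc neighboring_Cons)
  qed
  have "real (Suc n) * h * W = h * W + (\<Sum>x\<in>X. real n * h * v x)"
    by (simp add: W_def sum_distrib_left algebra_simps)
  also have "\<dots> \<le> (\<Sum>x\<in>X. v x * ln (W / v x)) + (\<Sum>x\<in>X. \<Sum>xs\<in>?D. w (x # xs) * ln (v x / w (x # xs)))"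
    unfolding W_def
    using entropy_bounded_ratio[OF X \<open>0 \<le> \<epsilon>\<close> vpos vratio h] tail
    by (intro add_mono sum_mono) auto
  \<comment> \<open>The chain rule: \<open>ln (W / w)\<close> splits as
    \<open>ln (W / v) + ln (v / w)\<close>.\<close>
  also have "\<dots> = (\<Sum>x\<in>X. \<Sum>xs\<in>?D. w (x # xs) * ln (W / w (x # xs)))"
  proof -
    have "v x * ln (W / v x) + (\<Sum>xs\<in>?D. w (x # xs) * ln (v x / w (x # xs)))
        = (\<Sum>xs\<in>?D. w (x # xs) * ln (W / w (x # xs)))" if "x \<in> X" for x
    proof -
      have "w (x # xs) * ln (W / w (x # xs))
          = w (x # xs) * ln (W / v x) + w (x # xs) * ln (v x / w (x # xs))" if "xs \<in> ?D" for xs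
        using wpos[OF \<open>x \<in> X\<close> that] vpos[OF \<open>x \<in> X\<close>] W by (simp add: ln_div algebra_simps)
      then have "(\<Sum>xs\<in>?D. w (x # xs) * ln (W / w (x # xs)))
          = (\<Sum>xs\<in>?D. w (x # xs) * ln (W / v x)) + (\<Sum>xs\<in>?D. w (x # xs) * ln (v x / w (x # xs)))"
        by (simp add: sum.distrib)
      then show ?thesis by (simp add: v_def sum_distrib_right)
    qed
    then show ?thesis by (simp flip: sum.distrib)
  qed
  finally show ?case
    unfolding W_eq sum_databases_Suc[of "\<lambda>l. w l * ln (W / w l)"] .
qed

section \<open>Shannon entropy\<close>

text \<open>As an expectation, the entropy can be compared pointwise on the support, and images and
  products of laws become changes of variables.\<close>

lemma shannon_entropy_altdef:
  "shannon_entropy p = (\<integral>\<^sup>+u. ennreal (- log 2 (pmf p u)) \<partial>measure_pmf p)"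
  unfolding shannon_entropy_def nn_integral_measure_pmf
proof (intro nn_integral_cong)
  fix u
  show "ennreal (- (pmf p u * log 2 (pmf p u))) = ennreal (pmf p u) * ennreal (- log 2 (pmf p u))"
    by (simp add: ennreal_mult'[symmetric])
qed

text \<open>At points of mass 0 this rests on the default value of the logarithm at 0.\<close>

lemma minus_log_pmf_nonneg: "0 \<le> - log 2 (pmf p u)"
  by (cases "pmf p u = 0") (auto simp: log_def pmf_le_1 less_le divide_nonpos_pos)

text \<open>A map can only merge atoms, so the mass at \<open>f u\<close> is at least the mass at
  \<open>u\<close>.\<close>

lemma shannon_entropy_map_le: "shannon_entropy (map_pmf f p) \<le> shannon_entropy p"
  unfolding shannon_entropy_altdef nn_integral_map_pmf
proof (rule nn_integral_mono_AE, unfold AE_measure_pmf_iff, rule ballI)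
  fix u assume "u \<in> set_pmf p"
  then have "0 < pmf p u" by (simp add: pmf_positive)
  moreover have "pmf p u \<le> pmf (map_pmf f p) (f u)"
    unfolding pmf_map by (simp add: pmf.rep_eq measure_pmf.finite_measure_mono)
  ultimately show "ennreal (- log 2 (pmf (map_pmf f p) (f u))) \<le> ennreal (- log 2 (pmf p u))"
    by (intro ennreal_leI) simp
qed

lemma shannon_entropy_map_inj:
  assumes "inj_on f (set_pmf p)"
  shows "shannon_entropy (map_pmf f p) = shannon_entropy p"
  unfolding shannon_entropy_altdef nn_integral_map_pmf
  by (rule nn_integral_cong_AE) (auto simp: AE_measure_pmf_iff pmf_map_inj[OF assms])

lemma shannon_entropy_pair:
  "shannon_entropy (pair_pmf p q) = shannon_entropy p + shannon_entropy q"
proof -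
  have "shannon_entropy (pair_pmf p q)
      = (\<integral>\<^sup>+a. \<integral>\<^sup>+b. ennreal (- log 2 (pmf p a)) + ennreal (- log 2 (pmf q b)) \<partial>q \<partial>p)"
    unfolding shannon_entropy_altdef nn_integral_pair_pmf' pmf_pair
  proof (rule nn_integral_cong_AE, unfold AE_measure_pmf_iff, rule ballI,
         rule nn_integral_cong_AE, unfold AE_measure_pmf_iff, rule ballI)
    fix a b assume "a \<in> set_pmf p" "b \<in> set_pmf q"
    then have "0 < pmf p a" "0 < pmf q b" by (simp_all add: pmf_positive)
    then have "- log 2 (pmf p a * pmf q b) = - log 2 (pmf p a) + - log 2 (pmf q b)"
      by (simp add: log_mult)
    then show "ennreal (- log 2 (pmf p a * pmf q b))
        = ennreal (- log 2 (pmf p a)) + ennreal (- log 2 (pmf q b))"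
      using minus_log_pmf_nonneg ennreal_plus by metis
  qed
  then show ?thesis
    by (simp add: nn_integral_add shannon_entropy_altdef)
qed

lemma shannon_entropy_return: "shannon_entropy (return_pmf a) = 0"
  by (simp add: shannon_entropy_altdef)

lemma replicate_pmf_Suc_pair:
  "replicate_pmf (Suc n) p = map_pmf (\<lambda>(x, xs). x # xs) (pair_pmf p (replicate_pmf n p))"
  by (simp add: pair_pmf_def map_bind_pmf)

lemma shannon_entropy_replicate:
  "shannon_entropy (replicate_pmf n p) = of_nat n * shannon_entropy p"
proof (induction n)
  case (Suc n)
  have "shannon_entropy (replicate_pmf (Suc n) p) = shannon_entropy (pair_pmf p (replicate_pmf n p))"
    unfolding replicate_pmf_Suc_pair by (rule shannon_entropy_map_inj) (auto simp: inj_on_def)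
  then show ?case
    using Suc by (simp add: shannon_entropy_pair distrib_right)
qed (simp add: shannon_entropy_return)

lemma shannon_entropy_finite:
  assumes "finite A" "set_pmf p \<subseteq> A"
  shows "shannon_entropy p = ennreal (\<Sum>u\<in>A. - (pmf p u * log 2 (pmf p u)))"
proof -
  have nonneg: "0 \<le> - (pmf p u * log 2 (pmf p u))" for u
    using mult_nonneg_nonneg[OF pmf_nonneg[of p u] minus_log_pmf_nonneg[of p u]] by simp
  have "shannon_entropy p = (\<Sum>u\<in>A. ennreal (- (pmf p u * log 2 (pmf p u))))"
    unfolding shannon_entropy_def
  proof (intro nn_integral_count_space')
    show "ennreal (- (pmf p u * log 2 (pmf p u))) = 0" if "u \<notin> A" for u
    proof -
      have "pmf p u = 0" using assms(2) that by (meson set_pmf_iff subsetD)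
      then show ?thesis by simp
    qed
  qed (use assms in auto)
  then show ?thesis using nonneg by (simp add: sum_ennreal del: sum_negf)
qed

text \<open>The factor \<open>ln 2\<close> converts nats into bits.\<close>

lemma shannon_entropy_U_min:
  assumes "s \<le> k" "0 < k"
  shows "shannon_entropy (U_min k \<epsilon> s) = ennreal (two_level_entropy k \<epsilon> (real s) / ln 2)"
proof -
  define t where "t = real s * exp \<epsilon> + real k - real s"
  have t: "0 < t" unfolding t_def using assms by (rule U_min_norm_pos)
  note pmf = pmf_U_min[OF assms, of \<epsilon>, folded t_def]
  have split: "{..<k} = {..<s} \<union> {s..<k}" using assms(1) by auto
  have "shannon_entropy (U_min k \<epsilon> s)
      = ennreal (\<Sum>u<k. - (pmf (U_min k \<epsilon> s) u * log 2 (pmf (U_min k \<epsilon> s) u)))"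
    using assms by (intro shannon_entropy_finite) (auto simp: set_pmf_iff pmf split: if_splits)
  also have "(\<Sum>u<k. - (pmf (U_min k \<epsilon> s) u * log 2 (pmf (U_min k \<epsilon> s) u)))
      = (\<Sum>u<s. - (exp \<epsilon> / t * log 2 (exp \<epsilon> / t))) + (\<Sum>u=s..<k. - (1 / t * log 2 (1 / t)))"
    unfolding split
    by (subst sum.union_disjoint) (auto intro!: arg_cong2[of _ _ _ _ "(+)"] sum.cong simp: pmf)
  also have "\<dots> = two_level_entropy k \<epsilon> (real s) / ln 2"
  proof -
    have "real s * (exp \<epsilon> / t * (\<epsilon> - ln t)) + (real k - real s) * (1 / t * (- ln t))
        = - two_level_entropy k \<epsilon> (real s)"
    proof -
      have "real s * (exp \<epsilon> / t * (\<epsilon> - ln t)) + (real k - real s) * (1 / t * (- ln t))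
         = real s * exp \<epsilon> * \<epsilon> / t - t / t * ln t"
        using t by (simp add: field_simps) (simp add: t_def algebra_simps)
      then show ?thesis using t by (simp add: two_level_entropy_def t_def Let_def)
    qed
    then have "two_level_entropy k \<epsilon> (real s) / ln 2
        = - (real s * (exp \<epsilon> / t * (\<epsilon> - ln t)) + (real k - real s) * (1 / t * (- ln t))) / ln 2"
      by simp
    also have "\<dots> = (\<Sum>u<s. - (exp \<epsilon> / t * log 2 (exp \<epsilon> / t))) + (\<Sum>u=s..<k. - (1 / t * log 2 (1 / t)))"
      using t assms(1)
      by (simp add: log_def ln_div of_nat_diff add_divide_distrib diff_divide_distrib algebra_simps)
    finally show ?thesis by simp
  qed
  finally show ?thesis .
qed

section \<open>Necessity\<close>

text \<open>The product form agrees with the quotients also for a zero denominator: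
  \<open>0 / 0 = 0\<close> always meets the bound, and \<open>a / 0 = \<infinity>\<close> with
  \<open>0 < a\<close> never does.\<close>

lemma differentially_private_iff:
  "differentially_private \<epsilon> X T U Y enc \<longleftrightarrow>
    (\<forall>x\<in>databases X T. \<forall>x'\<in>databases X T. neighboring x x' \<longrightarrow>
      (\<forall>y\<in>output_space T Y. mech_prob U enc y x \<le> exp \<epsilon> * mech_prob U enc y x'))"
proof -
  have "ennreal a / ennreal b \<le> ennreal (exp \<epsilon>) \<longleftrightarrow> a \<le> exp \<epsilon> * b"
    if "0 \<le> a" "0 \<le> b" for a b :: real
  proof (cases "b = 0")
    case True
    show ?thesis
    proof (cases "a = 0")
      case False
      then have "ennreal a / ennreal b = \<infinity>"
        using that True by (simp add: ennreal_divide_eq_top_iff ennreal_divide_zero)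
      then show ?thesis using True False that by (simp add: top_unique)
    qed (use True in simp)
  next
    case False
    then have "ennreal a / ennreal b = ennreal (a / b)"
      using that by (simp add: divide_ennreal)
    then show ?thesis using that False by (simp add: divide_le_eq)
  qed
  then show ?thesis
    unfolding differentially_private_def SUP_le_iff by (simp add: mech_prob_def)
qed

lemma DP_Rec_prob_pos:
  assumes "DP_Rec \<epsilon> X T U Y enc" "x \<in> databases X T" "x' \<in> databases X T"
    and "y \<in> output_space T Y" "0 < mech_prob U enc y x"
  shows "0 < mech_prob U enc y x'"
proof (rule databases_neighboring_induct[where P = "\<lambda>x. 0 < mech_prob U enc y x",
      OF _ assms(2,3,5)])
  fix z z' assume "z \<in> databases X T" "z' \<in> databases X T" "neighboring z z'" "0 < mech_prob U enc y z"
  then have "0 < exp \<epsilon> * mech_prob U enc y z'"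
    using assms(1,4) unfolding DP_Rec_def differentially_private_iff by (meson order_less_le_trans)
  then show "0 < mech_prob U enc y z'" by (simp add: zero_less_mult_iff)
qed

text \<open>Privacy makes an output attained for one database attained for all, so the keys applied
  to one fixed database already reach every attained output.\<close>

lemma DP_Rec_attained_lepoll:
  assumes "DP_Rec \<epsilon> X T U Y enc" "X \<noteq> {}"
  shows "attained_outputs X T U Y enc \<lesssim> set_pmf U"
proof -
  obtain x where x: "x \<in> databases X T" using databases_nonempty[OF assms(2)] by blast
  have "attained_outputs X T U Y enc \<subseteq> mech_output enc x ` set_pmf U"
  proof
    fix y assume "y \<in> attained_outputs X T U Y enc"
    then have "0 < mech_prob U enc y x"
      using DP_Rec_prob_pos[OF assms(1) _ x] by (auto simp: attained_outputs_def)
    then have "y \<in> set_pmf (map_pmf (mech_output enc x) U)"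
      by (simp only: mech_prob_def pmf_positive_iff)
    then show "y \<in> mech_output enc x ` set_pmf U" by simp
  qed
  then show ?thesis
    using subset_imp_lepoll image_lepoll lepoll_trans by blast
qed

lemma recoverable_inj:
  assumes "recoverable X T U enc" "u \<in> set_pmf U"
  shows "inj_on (\<lambda>x. mech_output enc x u) (databases X T)"
  using assms unfolding recoverable_def inj_on_def by metis

text \<open>One key of positive probability suffices: by recovery, its encoder is injective on
  databases.\<close>

lemma DP_Rec_databases_lepoll:
  assumes "DP_Rec \<epsilon> X T U Y enc"
  shows "databases X T \<lesssim> attained_outputs X T U Y enc"
proof -
  obtain u where u: "u \<in> set_pmf U" using set_pmf_not_empty[of U] by blast
  have "inj_on (\<lambda>x. mech_output enc x u) (databases X T)"
    using assms by (intro recoverable_inj[OF _ u]) (simp add: DP_Rec_def)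
  moreover have "(\<lambda>x. mech_output enc x u) ` databases X T \<subseteq> attained_outputs X T U Y enc"
    using assms u
    by (fastforce simp: attained_outputs_def DP_Rec_def mech_prob_def pmf_positive_iff)
  ultimately show ?thesis unfolding lepoll_def by blast
qed

lemma recoverable_sum_prob_le_1:
  assumes "recoverable X T U enc" "finite X"
  shows "(\<Sum>x\<in>databases X T. mech_prob U enc y x) \<le> 1"
proof -
  \<comment> \<open>A key in both \<open>K x\<close> and \<open>K x'\<close> would have to decode
    \<open>y\<close> to both databases.\<close>
  define K where "K x = {u \<in> set_pmf U. mech_output enc x u = y}" for x
  have "mech_prob U enc y x = measure U (K x)" for x
  proof -
    have "K x = (mech_output enc x -` {y}) \<inter> set_pmf U" by (auto simp: K_def)
    then show ?thesis by (simp add: mech_prob_def pmf_map measure_Int_set_pmf)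
  qed
  moreover have "disjoint_family_on K (databases X T)"
    using recoverable_inj[OF assms(1)] by (fastforce simp: disjoint_family_on_def K_def inj_on_def)
  then have "(\<Sum>x\<in>databases X T. measure U (K x)) = measure U (\<Union>x\<in>databases X T. K x)"
    using finite_databases[OF assms(2)]
    by (intro measure_pmf.finite_measure_finite_Union[symmetric]) auto
  ultimately show ?thesis by simp
qed

lemma DP_Rec_entropy_ge:
  fixes X :: "'x set"
  assumes DP: "DP_Rec \<epsilon> X T U Y enc" and X: "finite X" "X \<noteq> {}" and "0 \<le> \<epsilon>"
    and h: "\<And>s. s \<le> card X \<Longrightarrow> h \<le> two_level_entropy (card X) \<epsilon> (real s)"
  shows "ennreal (real T * (h / ln 2)) \<le> shannon_entropy U"
proof -
  let ?D = "databases X T" and ?c = "real T * (h / ln 2)"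
  define Q where "Q x y = mech_prob U enc y x" for x y
  define \<phi> where "\<phi> q = - (q * log 2 q)" for q :: real
  have D: "finite ?D" "?D \<noteq> {}" using X finite_databases databases_nonempty by blast+
  have rec: "recoverable X T U enc" using DP by (simp add: DP_Rec_def)
  have Q0: "0 \<le> Q x y" for x y by (simp add: Q_def mech_prob_def)
  have \<phi>0: "0 \<le> \<phi> (Q x y)" for x y
    using mult_nonneg_nonneg[OF Q0[of x y] minus_log_pmf_nonneg[of "map_pmf (mech_output enc x) U" y]]
    by (simp add: \<phi>_def Q_def mech_prob_def)
  have bound: "(\<Sum>x\<in>?D. Q x y) * ?c \<le> (\<Sum>x\<in>?D. \<phi> (Q x y))" for y
  proof (cases "y \<in> output_space T Y \<and> (\<exists>x\<in>?D. 0 < Q x y)")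
    case True
    then have pos: "0 < Q x y" if "x \<in> ?D" for x
      using DP_Rec_prob_pos[OF DP] that unfolding Q_def by blast
    define S where "S = (\<Sum>x\<in>?D. Q x y)"
    have S: "0 < S" "S \<le> 1"
      using D pos recoverable_sum_prob_le_1[OF rec X(1)] unfolding S_def Q_def
      by (auto intro!: sum_pos)
    have "real T * h * S \<le> (\<Sum>x\<in>?D. Q x y * ln (S / Q x y))"
      unfolding S_def using DP True unfolding DP_Rec_def differentially_private_iff
      by (intro entropy_databases_bounded_ratio[OF X \<open>0 \<le> \<epsilon>\<close> h] pos) (auto simp: Q_def)
    \<comment> \<open>Recovery enters through \<open>S \<le> 1\<close>, which makes
      \<open>ln S\<close> nonpositive.\<close>
    also have "\<dots> \<le> (\<Sum>x\<in>?D. Q x y * (- ln (Q x y)))"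
      using S pos by (intro sum_mono mult_left_mono) (auto simp: ln_div less_imp_le)
    finally have "real T * h * S / ln 2 \<le> (\<Sum>x\<in>?D. Q x y * (- ln (Q x y))) / ln 2"
      by (intro divide_right_mono) auto
    then show ?thesis
      by (simp add: S_def[symmetric] \<phi>_def log_def sum_divide_distrib sum_negf mult_ac)
  next
    \<comment> \<open>Such an output is either impossible for every database in its space or lies
      outside the space and is never produced.\<close>
    case False
    have "Q x y = 0" if "x \<in> ?D" for x
    proof (cases "y \<in> output_space T Y")
      case True
      then show ?thesis using False Q0[of x y] that by force
    next
      case False
      then have "y \<notin> mech_output enc x ` set_pmf U"
        using DP that by (auto simp: DP_Rec_def)
      then show ?thesis by (simp add: Q_def mech_prob_def pmf_map_outside)
    qed
    then show ?thesis by (simp add: \<phi>_def)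
  qed
  \<comment> \<open>Double counting: each law \<open>Q x\<close> has total mass 1, so summing
    \<open>bound\<close> over all outputs compares \<open>card ?D\<close> copies of
    \<open>?c\<close> with the sum of the output entropies.\<close>
  have "of_nat (card ?D) * ennreal ?c = (\<Sum>x\<in>?D. \<integral>\<^sup>+y. ennreal (Q x y) \<partial>count_space UNIV) * ennreal ?c"
    by (simp add: Q_def mech_prob_def nn_integral_pmf_eq_1)
  also have "\<dots> = (\<integral>\<^sup>+y. (\<Sum>x\<in>?D. ennreal (Q x y)) * ennreal ?c \<partial>count_space UNIV)"
    by (simp add: nn_integral_sum nn_integral_multc)
  also have "\<dots> = (\<integral>\<^sup>+y. ennreal ((\<Sum>x\<in>?D. Q x y) * ?c) \<partial>count_space UNIV)"
  proof (rule nn_integral_cong)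
    fix y
    have "ennreal ((\<Sum>x\<in>?D. Q x y) * ?c) = ennreal (\<Sum>x\<in>?D. Q x y) * ennreal ?c"
      using Q0 by (intro ennreal_mult' sum_nonneg) auto
    then show "(\<Sum>x\<in>?D. ennreal (Q x y)) * ennreal ?c = ennreal ((\<Sum>x\<in>?D. Q x y) * ?c)"
      using Q0 by (simp only: sum_ennreal)
  qed
  also have "\<dots> \<le> (\<integral>\<^sup>+y. (\<Sum>x\<in>?D. ennreal (\<phi> (Q x y))) \<partial>count_space UNIV)"
    using bound \<phi>0 by (intro nn_integral_mono) (simp add: ennreal_leI)
  also have "\<dots> = (\<Sum>x\<in>?D. shannon_entropy (map_pmf (mech_output enc x) U))"
    by (simp add: nn_integral_sum shannon_entropy_def Q_def mech_prob_def \<phi>_def)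
  also have "\<dots> \<le> (\<Sum>x\<in>?D. shannon_entropy U)"
    by (intro sum_mono shannon_entropy_map_le)
  also have "\<dots> = of_nat (card ?D) * shannon_entropy U" by simp
  \<comment> \<open>The factor \<open>card ?D\<close> is finite and nonzero, hence cancels in
    \<open>ennreal\<close>.\<close>
  finally show ?thesis
    using D by (subst (asm) ennreal_mult_le_mult_iff) (auto simp: card_gt_0_iff)
qed

section \<open>Mechanisms\<close>

lemma listset_replicate_singleton_snoc:
  "listset (replicate n {a} @ [B]) = (\<lambda>b. replicate n a @ [b]) ` B"
proof (induction n)
  case (Suc n)
  then show ?case by (simp add: set_Cons_def) blast
qed (auto simp: set_Cons_def)

text \<open>All outputs but the last one are constant; the last one may depend on the whole database.\<close>

lemma one_shot_mechanism:
  fixes X :: "'x set" and V :: "'v::countable pmf" and e :: "'x list \<Rightarrow> 'v \<Rightarrow> 'b::countable"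
  assumes "1 \<le> T" and "X \<noteq> {}"
    and range: "\<And>x. x \<in> databases X T \<Longrightarrow> e x ` set_pmf V = B"
    and inj: "\<And>v. v \<in> set_pmf V \<Longrightarrow> inj_on (\<lambda>x. e x v) (databases X T)"
    and dp: "\<And>x x' y. x \<in> databases X T \<Longrightarrow> x' \<in> databases X T \<Longrightarrow> neighboring x x' \<Longrightarrow>
      pmf (map_pmf (e x) V) y \<le> exp \<epsilon> * pmf (map_pmf (e x') V) y"
  shows "\<exists>(U :: nat pmf) (Y :: nat \<Rightarrow> nat set) enc. DP_Rec \<epsilon> X T U Y enc \<and>
    attained_outputs X T U Y enc = output_space T Y \<and>
    set_pmf U \<approx> set_pmf V \<and> output_space T Y \<approx> B \<and> shannon_entropy U = shannon_entropy V"
proof -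
  \<comment> \<open>Time starts at 0, so \<open>n\<close> is the index of the last output.\<close>
  obtain n where T: "T = Suc n" using \<open>1 \<le> T\<close> by (cases T) auto
  define U where "U = map_pmf to_nat V"
  define Y where "Y t = (if t = n then to_nat ` B else {0})" for t
  define enc where "enc t x u = (if t = n then to_nat (e x (from_nat u)) else 0)" for t x u
  define emb where "emb b = replicate n 0 @ [to_nat b]" for b :: 'b
  have inj_emb: "inj emb" by (simp add: inj_def emb_def)
  have const_map: "map f [0..<n] = replicate n c" if "\<And>t. t < n \<Longrightarrow> f t = c" for f :: "nat \<Rightarrow> 'c" and c
    using that by (intro nth_equalityI) auto
  have out: "mech_output enc x (to_nat v) = emb (e x v)" if "x \<in> databases X T" for x v
  proof -
    have "length x = Suc n" using that by (simp add: databases_def T)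
    moreover have "map (\<lambda>t. enc t (take (Suc t) x) (to_nat v)) [0..<n] = replicate n 0"
      by (rule const_map) (simp add: enc_def)
    ultimately show ?thesis by (simp add: mech_output_def emb_def enc_def)
  qed
  have space: "output_space T Y = emb ` B"
  proof -
    have "map Y [0..<n] = replicate n {0}" by (rule const_map) (simp add: Y_def)
    then have "output_space T Y = listset (replicate n {0} @ [to_nat ` B])"
      by (simp add: output_space_def T Y_def)
    then show ?thesis
      by (simp add: listset_replicate_singleton_snoc emb_def image_image)
  qed
  have prob: "mech_prob U enc (emb b) x = pmf (map_pmf (e x) V) b" if "x \<in> databases X T" for x b
  proof -
    have "map_pmf (mech_output enc x) U = map_pmf emb (map_pmf (e x) V)"
      unfolding U_def map_pmf_comp using out[OF that] by simp
    then show ?thesis using inj_emb by (simp add: mech_prob_def pmf_map_inj')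
  qed
  have "recoverable X T U enc"
    unfolding recoverable_def
  \<comment> \<open>The decoder inverts the encoder belonging to the given key.\<close>
  proof (intro exI[of _ "\<lambda>u. inv_into (databases X T) (\<lambda>x. mech_output enc x u)"] ballI)
    fix x u assume x: "x \<in> databases X T" and "u \<in> set_pmf U"
    then obtain v where v: "v \<in> set_pmf V" "u = to_nat v" by (auto simp: U_def)
    have "inj_on (\<lambda>x. mech_output enc x u) (databases X T)"
    proof (rule inj_onI)
      fix a b assume ab: "a \<in> databases X T" "b \<in> databases X T"
        "mech_output enc a u = mech_output enc b u"
      then have "e a v = e b v" using out v inj_emb by (simp add: inj_eq)
      then show "a = b" using inj[OF v(1)] ab by (auto dest: inj_onD)
    qed
    then show "inv_into (databases X T) (\<lambda>x. mech_output enc x u) (mech_output enc x u) = x"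
      by (rule inv_into_f_f[OF _ x])
  qed
  moreover have "differentially_private \<epsilon> X T U Y enc"
    unfolding differentially_private_iff space using dp by (auto simp: prob)
  moreover have "mech_output enc x u \<in> output_space T Y"
    if "x \<in> databases X T" "u \<in> set_pmf U" for x u
    using that out[OF that(1)] range[OF that(1)] by (auto simp: U_def space)
  ultimately have "DP_Rec \<epsilon> X T U Y enc" by (simp add: DP_Rec_def)
  moreover have "attained_outputs X T U Y enc = output_space T Y"
  proof -
    obtain x where x: "x \<in> databases X T" using databases_nonempty[OF \<open>X \<noteq> {}\<close>] by blast
    have "0 < mech_prob U enc (emb b) x" if "b \<in> B" for b
    proof -
      have "b \<in> set_pmf (map_pmf (e x) V)" using that range[OF x] by auto
      then show ?thesis unfolding prob[OF x] by (rule pmf_positive)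
    qed
    then show ?thesis using x by (auto simp: attained_outputs_def space)
  qed
  moreover have "set_pmf U \<approx> set_pmf V"
    unfolding U_def set_map_pmf by (rule inj_on_image_eqpoll_self) simp
  moreover have "output_space T Y \<approx> B"
    unfolding space using inj_emb by (intro inj_on_image_eqpoll_self) (simp add: inj_on_def inj_def)
  moreover have "shannon_entropy U = shannon_entropy V"
    unfolding U_def by (rule shannon_entropy_map_inj) simp
  ultimately show ?thesis by blast
qed

section \<open>One-time pads by cyclic shifts\<close>

text \<open>Number the elements of \<open>X\<close> and add modulo \<open>L\<close>. Bijectivity in
  the key controls the output law; injectivity in the sample gives recovery. \<open>L\<close> may
  exceed \<open>card X\<close>, as the pads on blocks require.\<close>

lemma cyclic_shifts_exist:
  assumes "finite X" "card X \<le> L"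
  obtains s :: "'x \<Rightarrow> nat \<Rightarrow> nat"
  where "\<And>a. a \<in> X \<Longrightarrow> bij_betw (s a) {..<L} {..<L}"
    and "\<And>c. c < L \<Longrightarrow> inj_on (\<lambda>a. s a c) X"
proof -
  obtain f :: "'x \<Rightarrow> nat" where "bij_betw f X {..<card X}"
    using ex_bij_betw_finite_nat[OF assms(1)] by (auto simp: atLeast0LessThan)
  then have f: "inj_on f X" "\<And>a. a \<in> X \<Longrightarrow> f a < L"
    using assms(2) by (auto simp: bij_betw_def dest!: equalityD1)
  \<comment> \<open>Both summands are below \<open>L\<close>, so one subtraction reduces modulo
    \<open>L\<close>.\<close>
  define s where "s a c = (if f a + c < L then f a + c else f a + c - L)" for a c
  show thesis
  proof
    fix a assume a: "a \<in> X"
    have "inj_on (s a) {..<L}" by (auto simp: s_def inj_on_def split: if_splits)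
    moreover have "s a ` {..<L} \<subseteq> {..<L}"
    proof (rule image_subsetI)
      fix c assume "c \<in> {..<L}"
      then show "s a c \<in> {..<L}" using f(2)[OF a] by (cases "f a + c < L") (auto simp: s_def)
    qed
    ultimately show "bij_betw (s a) {..<L} {..<L}"
      by (simp add: bij_betw_def endo_inj_surj)
  next
    fix c assume c: "c < L"
    show "inj_on (\<lambda>a. s a c) X"
    proof (rule inj_onI)
      fix a b assume ab: "a \<in> X" "b \<in> X" "s a c = s b c"
      then have "f a = f b" using f(2)[of a] f(2)[of b] c by (simp add: s_def split: if_splits)
      then show "a = b" using f(1) ab by (auto dest: inj_onD)
    qed
  qed
qed

text \<open>Here \<open>databases N n\<close> and \<open>databases M n\<close> serve as the sets of
  key lists and of output lists.\<close>

lemma map2_bij_betw_databases: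
  assumes "\<And>a. a \<in> X \<Longrightarrow> bij_betw (s a) N M" "x \<in> databases X n"
  shows "bij_betw (map2 s x) (databases N n) (databases M n)"
  using assms(2)
proof (induction n arbitrary: x)
  case (Suc n)
  then obtain a xs where x: "x = a # xs" "a \<in> X" "xs \<in> databases X n"
    by (auto simp: databases_Suc)
  have IH: "inj_on (map2 s xs) (databases N n)" "map2 s xs ` databases N n = databases M n"
    using Suc.IH[OF x(3)] by (auto simp: bij_betw_def)
  have s: "inj_on (s a) N" "s a ` N = M" using assms(1)[OF x(2)] by (auto simp: bij_betw_def)
  have "inj_on (map2 s x) (databases N (Suc n))"
  proof (rule inj_onI)
    fix u v assume "u \<in> databases N (Suc n)" "v \<in> databases N (Suc n)" and eq: "map2 s x u = map2 s x v"
    then obtain c cs d ds where u: "u = c # cs" "c \<in> N" "cs \<in> databases N n"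
      and v: "v = d # ds" "d \<in> N" "ds \<in> databases N n"
      by (auto simp: databases_Suc)
    from eq have "s a c = s a d" "map2 s xs cs = map2 s xs ds" by (simp_all add: x(1) u(1) v(1))
    then show "u = v"
      using inj_onD[OF s(1) _ u(2) v(2)] inj_onD[OF IH(1) _ u(3) v(3)] by (simp add: u(1) v(1))
  qed
  moreover have "map2 s x ` databases N (Suc n) = databases M (Suc n)"
  proof -
    have "map2 s x ` databases N (Suc n) = (\<lambda>(c, cs). s a c # map2 s xs cs) ` (N \<times> databases N n)"
      unfolding databases_Suc image_image by (rule image_cong) (auto simp: x(1))
    also have "\<dots> = (\<lambda>(d, ds). d # ds) ` ((s a ` N) \<times> (map2 s xs ` databases N n))"
      unfolding image_paired_Times[symmetric] image_image by (simp add: case_prod_unfold)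
    finally show ?thesis unfolding IH(2) s(2) databases_Suc .
  qed
  ultimately show ?case by (simp add: bij_betw_def)
qed (auto simp: databases_0)

lemma pmf_replicate_pmf_Suc:
  "pmf (replicate_pmf (Suc n) p) (a # as) = pmf p a * pmf (replicate_pmf n p) as"
proof -
  have "inj (\<lambda>(x, xs). x # xs)" by (auto simp: inj_def)
  from pmf_map_inj'[OF this, of _ "(a, as)"] show ?thesis
    by (simp add: replicate_pmf_Suc_pair pmf_pair del: replicate_pmf.simps)
qed

lemma set_pmf_replicate_databases: "set_pmf (replicate_pmf n p) = databases (set_pmf p) n"
  by (auto simp: set_replicate_pmf databases_def)

text \<open>Two keys that give the same output on neighboring databases agree wherever the databases
  agree, since each \<open>s a\<close> is injective. Their product masses therefore differ in at
  most one factor.\<close>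

lemma shifted_key_ratio:
  assumes bij: "\<And>a. a \<in> X \<Longrightarrow> bij_betw (s a) N M"
    and ratio: "\<And>c d. c \<in> N \<Longrightarrow> d \<in> N \<Longrightarrow> pmf p c \<le> r * pmf p d"
    and "x \<in> databases X n" "x' \<in> databases X n" "neighboring x x'"
    and "u \<in> databases N n" "u' \<in> databases N n" "map2 s x u = map2 s x' u'"
  shows "pmf (replicate_pmf n p) u \<le> r * pmf (replicate_pmf n p) u'"
  using assms(3-)
proof (induction n arbitrary: x x' u u')
  case 0
  then show ?case by (simp add: databases_0 neighboring_def)
next
  case (Suc n)
  obtain a xs b ys where x: "x = a # xs" "x' = b # ys" "a \<in> X" "b \<in> X"
    "xs \<in> databases X n" "ys \<in> databases X n"
    using Suc.prems(1,2) by (auto simp: databases_Suc)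
  obtain c us d us' where u: "u = c # us" "u' = d # us'" "c \<in> N" "d \<in> N"
    "us \<in> databases N n" "us' \<in> databases N n"
    using Suc.prems(4,5) by (auto simp: databases_Suc)
  have eq: "s a c = s b d" "map2 s xs us = map2 s ys us'"
    using Suc.prems(6) by (simp_all add: x u)
  show ?case
  proof (cases "a = b")
    case True
    then have "c = d" using eq(1) bij[OF x(3)] u by (auto simp: bij_betw_def dest: inj_onD)
    moreover have "pmf (replicate_pmf n p) us \<le> r * pmf (replicate_pmf n p) us'"
      using Suc.IH[OF x(5,6) _ u(5,6) eq(2)] Suc.prems(3) True by (simp add: x neighboring_Cons)
    ultimately show ?thesis
      unfolding u pmf_replicate_pmf_Suc
      by (simp add: mult.left_commute[of r] mult_left_mono del: replicate_pmf.simps)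
  next
    case False
    then have "xs = ys" using Suc.prems(3) by (simp add: x neighboring_Cons)
    then have "us = us'"
      using map2_bij_betw_databases[of X s N M, OF bij x(5)] eq(2) u
      by (auto simp: bij_betw_def dest: inj_onD)
    then show ?thesis
      unfolding u pmf_replicate_pmf_Suc
      using mult_right_mono[OF ratio[OF u(3,4)], of "pmf (replicate_pmf n p) us"]
      by (simp add: mult_ac del: replicate_pmf.simps)
  qed
qed

lemma inj_on_map2_key:
  assumes "\<And>c. c \<in> N \<Longrightarrow> inj_on (\<lambda>a. s a c) X" "u \<in> databases N n"
  shows "inj_on (\<lambda>x. map2 s x u) (databases X n)"
  using assms(2)
proof (induction n arbitrary: u)
  case (Suc n)
  then obtain c us where u: "u = c # us" "c \<in> N" "us \<in> databases N n"
    by (auto simp: databases_Suc)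
  show ?case
    using Suc.IH[OF u(3)] assms(1)[OF u(2)]
    by (auto simp: inj_on_def databases_Suc u(1))
qed (simp add: databases_0)

lemma iid_shift_mechanism:
  fixes X :: "'x set" and p W :: "nat pmf"
  assumes "1 \<le> T" "finite X" "X \<noteq> {}"
    and p: "set_pmf p = {..<card X}"
    and ratio: "\<And>c d. c < card X \<Longrightarrow> d < card X \<Longrightarrow> pmf p c \<le> exp \<epsilon> * pmf p d"
  shows "\<exists>(U :: nat pmf) (Y :: nat \<Rightarrow> nat set) enc. DP_Rec \<epsilon> X T U Y enc \<and>
    attained_outputs X T U Y enc = output_space T Y \<and>
    set_pmf U \<approx> databases X T \<times> set_pmf W \<and> output_space T Y \<approx> databases X T \<and>
    shannon_entropy U = of_nat T * shannon_entropy p + shannon_entropy W"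
proof -
  let ?N = "{..<card X}"
  obtain s :: "'x \<Rightarrow> nat \<Rightarrow> nat"
    where bij: "\<And>a. a \<in> X \<Longrightarrow> bij_betw (s a) ?N ?N" and inj: "\<And>c. c < card X \<Longrightarrow> inj_on (\<lambda>a. s a c) X"
    using cyclic_shifts_exist[OF \<open>finite X\<close> order_refl] by metis
  \<comment> \<open>The component \<open>W\<close> is dropped by \<open>e\<close>; it affects only
    the size and the entropy of the key.\<close>
  define V where "V = pair_pmf (replicate_pmf T p) W"
  define e where "e x v = map2 s x (fst v)" for x and v :: "nat list \<times> nat"
  have set_V: "set_pmf V = databases ?N T \<times> set_pmf W"
    by (simp add: V_def set_pmf_replicate_databases p)
  have map_e: "map_pmf (e x) V = map_pmf (map2 s x) (replicate_pmf T p)" for x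
  proof -
    have "map_pmf (e x) V = map_pmf (map2 s x) (map_pmf fst V)"
      unfolding map_pmf_comp e_def ..
    then show ?thesis by (simp add: V_def map_fst_pair_pmf)
  qed
  have bij2: "bij_betw (map2 s x) (databases ?N T) (databases ?N T)" if "x \<in> databases X T" for x
    using map2_bij_betw_databases[OF bij that] .
  have "\<exists>(U :: nat pmf) (Y :: nat \<Rightarrow> nat set) enc. DP_Rec \<epsilon> X T U Y enc \<and>
    attained_outputs X T U Y enc = output_space T Y \<and>
    set_pmf U \<approx> set_pmf V \<and> output_space T Y \<approx> databases ?N T \<and> shannon_entropy U = shannon_entropy V"
  proof (rule one_shot_mechanism[OF \<open>1 \<le> T\<close> \<open>X \<noteq> {}\<close>, where e = e])
    show "e x ` set_pmf V = databases ?N T" if "x \<in> databases X T" for x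
    proof -
      have "e x ` set_pmf V = map2 s x ` databases ?N T"
        using set_pmf_not_empty[of W] by (force simp: set_V e_def)
      then show ?thesis using bij2[OF that] by (simp add: bij_betw_def)
    qed
    show "inj_on (\<lambda>x. e x v) (databases X T)" if "v \<in> set_pmf V" for v
      unfolding e_def using inj that set_V by (intro inj_on_map2_key[of ?N]) auto
    show "pmf (map_pmf (e x) V) y \<le> exp \<epsilon> * pmf (map_pmf (e x') V) y"
      if x: "x \<in> databases X T" "x' \<in> databases X T" "neighboring x x'" for x x' y
    proof (cases "y \<in> databases ?N T")
      case True
      have "y \<in> map2 s x ` databases ?N T" "y \<in> map2 s x' ` databases ?N T"
        unfolding bij_betw_imp_surj_on[OF bij2[OF x(1)]] bij_betw_imp_surj_on[OF bij2[OF x(2)]]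
        using True by simp_all
      then obtain u u' where u: "u \<in> databases ?N T" "u' \<in> databases ?N T"
        "y = map2 s x u" "y = map2 s x' u'"
        by (elim imageE)
      \<comment> \<open>For a fixed database, keys and outputs correspond one to one, so the mass of
        an output is that of its key.\<close>
      have pmf_y: "pmf (map_pmf (map2 s z) (replicate_pmf T p)) (map2 s z w) = pmf (replicate_pmf T p) w"
        if "z \<in> databases X T" "w \<in> databases ?N T" for z w
        using bij_betw_imp_inj_on[OF bij2[OF that(1)]] that(2)
        by (intro pmf_map_inj) (simp_all only: set_pmf_replicate_databases p)
      have "pmf (replicate_pmf T p) u \<le> exp \<epsilon> * pmf (replicate_pmf T p) u'"
      proof (rule shifted_key_ratio[OF bij _ x u(1,2)])
        show "pmf p c \<le> exp \<epsilon> * pmf p d" if "c \<in> ?N" "d \<in> ?N" for c d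
          using that by (intro ratio) auto
        show "map2 s x u = map2 s x' u'" using u(3,4) by (rule subst)
      qed
      moreover have "pmf (map_pmf (e x) V) y = pmf (replicate_pmf T p) u"
        unfolding map_e u(3) by (rule pmf_y[OF x(1) u(1)])
      moreover have "pmf (map_pmf (e x') V) y = pmf (replicate_pmf T p) u'"
        unfolding map_e u(4) by (rule pmf_y[OF x(2) u(2)])
      ultimately show ?thesis by simp
    next
      case False
      then have "y \<notin> map2 s x ` set_pmf (replicate_pmf T p)"
        using bij2[OF x(1)] by (simp add: bij_betw_def set_pmf_replicate_databases p)
      then have "pmf (map_pmf (e x) V) y = 0"
        unfolding map_e by (rule pmf_map_outside)
      then show ?thesis by simp
    qed
  qed
  then obtain U :: "nat pmf" and Y :: "nat \<Rightarrow> nat set" and enc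
    where U: "DP_Rec \<epsilon> X T U Y enc" "attained_outputs X T U Y enc = output_space T Y"
      "set_pmf U \<approx> set_pmf V" "output_space T Y \<approx> databases ?N T" "shannon_entropy U = shannon_entropy V"
    by blast
  have N: "databases ?N T \<approx> databases X T"
    using \<open>finite X\<close> by (simp add: eqpoll_iff_card finite_databases card_databases)
  then have "set_pmf V \<approx> databases X T \<times> set_pmf W"
    unfolding set_V by (intro times_eqpoll_cong) auto
  then have "set_pmf U \<approx> databases X T \<times> set_pmf W"
    using U(3) eqpoll_trans by blast
  moreover have "output_space T Y \<approx> databases X T"
    using U(4) N eqpoll_trans by blast
  moreover have "shannon_entropy V = of_nat T * shannon_entropy p + shannon_entropy W"
    by (simp add: V_def shannon_entropy_pair shannon_entropy_replicate)
  ultimately show ?thesis using U(1,2,5) by auto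
qed

section \<open>Laws with prescribed entropy\<close>

text \<open>Choose a block \<open>j\<close> with probability \<open>2 ^ - (j + 1)\<close> and then one of its \<open>2 ^ 2 ^ (j + 1)\<close>
  elements uniformly: block \<open>j\<close> contributes at least \<open>1\<close> to the entropy.\<close>

lemma exists_pmf_infinite_entropy: "\<exists>W :: nat pmf. shannon_entropy W = \<infinity>"
proof -
  define M :: "nat \<Rightarrow> nat" where "M j = 2 ^ (2 ^ Suc j)" for j
  define V where "V = geometric_pmf (1/2) \<bind> (\<lambda>j. map_pmf (Pair j) (pmf_of_set {..<M j}))"
  have M: "0 < M j" for j by (simp add: M_def)
  then have ne: "{..<M j} \<noteq> {}" for j by (auto simp: lessThan_empty_iff)
  \<comment> \<open>A point is reached only through its own block; the probability of the block is
    bounded by 1.\<close>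
  have le: "pmf V (j, m) \<le> 1 / real (M j)" for j m
  proof -
    have "pmf (map_pmf (Pair i) (pmf_of_set {..<M i})) (j, m) \<le> 1 / real (M j)" for i
    proof (cases "i = j")
      case True
      have "pmf (map_pmf (Pair j) (pmf_of_set {..<M j})) (j, m) = pmf (pmf_of_set {..<M j}) m"
        by (rule pmf_map_inj') (simp add: inj_def)
      then show ?thesis using True ne[of j] by (simp add: pmf_of_set indicator_def)
    next
      case False
      then have "pmf (map_pmf (Pair i) (pmf_of_set {..<M i})) (j, m) = 0"
        by (intro pmf_map_outside) auto
      then show ?thesis by simp
    qed
    then have "ennreal (pmf V (j, m)) \<le> (\<integral>\<^sup>+i. ennreal (1 / real (M j)) \<partial>geometric_pmf (1/2))"
      unfolding V_def ennreal_pmf_bind by (intro nn_integral_mono ennreal_leI)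
    then show ?thesis by (simp add: measure_pmf.emeasure_space_1)
  qed
  have "(\<integral>\<^sup>+j. ennreal (2 ^ Suc j) \<partial>geometric_pmf (1/2)) \<le> shannon_entropy V"
  proof -
    have "ennreal (2 ^ Suc j) \<le> ennreal (- log 2 (pmf V (j, m)))" if "(j, m) \<in> set_pmf V" for j m
    proof (rule ennreal_leI)
      have "log 2 (pmf V (j, m)) \<le> log 2 (1 / real (M j))"
        using le[of j m] M[of j] pmf_positive[OF that] by simp
      also have "\<dots> = - log 2 (2 ^ (2 ^ Suc j))" by (simp add: M_def log_divide)
      also have "\<dots> = - (2 ^ Suc j)" by (simp only: log_pow_cancel of_nat_power of_nat_numeral)
      finally show "2 ^ Suc j \<le> - log 2 (pmf V (j, m))" by simp
    qed
    then have "(\<integral>\<^sup>+z. ennreal (2 ^ Suc (fst z)) \<partial>V) \<le> shannon_entropy V"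
      unfolding shannon_entropy_altdef by (intro nn_integral_mono_AE) (auto simp: AE_measure_pmf_iff)
    moreover have "(\<integral>\<^sup>+z. ennreal (2 ^ Suc (fst z)) \<partial>V) = (\<integral>\<^sup>+j. ennreal (2 ^ Suc j) \<partial>geometric_pmf (1/2))"
      unfolding V_def by (simp add: measure_pmf.emeasure_space_1 del: power_Suc)
    ultimately show ?thesis by simp
  qed
  \<comment> \<open>The weight \<open>2 ^ - (j + 1)\<close> of block \<open>j\<close> cancels the
    factor \<open>2 ^ Suc j\<close>, leaving infinitely many terms equal to 1.\<close>
  moreover have "(\<integral>\<^sup>+j. ennreal (2 ^ Suc j) \<partial>geometric_pmf (1/2)) = (\<integral>\<^sup>+j. 1 \<partial>count_space (UNIV :: nat set))"
    unfolding nn_integral_measure_pmf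
    by (intro nn_integral_cong) (simp add: power_divide flip: ennreal_mult')
  ultimately have "shannon_entropy V = \<infinity>" by (simp add: top_unique)
  then have "shannon_entropy (map_pmf to_nat V) = \<infinity>"
    by (subst shannon_entropy_map_inj) auto
  then show ?thesis by blast
qed

text \<open>As \<open>\<epsilon>\<close> grows from \<open>0\<close> to \<open>\<infinity>\<close>, the entropy of \<open>U_min n \<epsilon> 1\<close> moves continuously from
  \<open>log 2 n\<close> to \<open>0\<close>.\<close>

lemma exists_pmf_finite_entropy:
  assumes "0 \<le> r"
  shows "\<exists>W :: nat pmf. shannon_entropy W = ennreal r"
proof (cases "r = 0")
  case True
  then show ?thesis using shannon_entropy_return[of "0 :: nat"] by auto
next
  case False
  \<comment> \<open>This makes \<open>log 2 n\<close> at least \<open>r\<close>, and the summand 1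
    ensures \<open>2 \<le> n\<close>, hence \<open>0 < c\<close>. Below, \<open>\<epsilon>\<close>
    is only an interpolation parameter.\<close>
  define n :: nat where "n = 2 ^ nat \<lceil>r\<rceil> + 1"
  have n: "2 \<le> n" by (simp add: n_def)
  define c where "c = real n - 1"
  have c: "0 < c" using n by (simp add: c_def)
  let ?f = "\<lambda>\<epsilon>. two_level_entropy n \<epsilon> 1"
  have f: "?f \<epsilon> = ln (exp \<epsilon> + c) - exp \<epsilon> * \<epsilon> / (exp \<epsilon> + c)" for \<epsilon>
    by (simp add: two_level_entropy_def Let_def c_def algebra_simps)
  \<comment> \<open>Both terms are \<open>\<epsilon>\<close> up to a vanishing error.\<close>
  have "((\<lambda>\<epsilon>. ln (exp \<epsilon> + c) - exp \<epsilon> * \<epsilon> / (exp \<epsilon> + c)) \<longlongrightarrow> 0) at_top"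
    using c by real_asymp
  moreover have "0 < r * ln 2" using assms False by simp
  ultimately have "\<forall>\<^sub>F \<epsilon> in at_top. ?f \<epsilon> < r * ln 2"
    unfolding f by (rule order_tendstoD(2))
  then obtain b where b: "0 \<le> b" "?f b \<le> r * ln 2"
    using eventually_happens[OF eventually_conj[OF eventually_ge_at_top[of 0]]] by fastforce
  have "r * ln 2 \<le> ?f 0"
  proof -
    have "r \<le> real (nat \<lceil>r\<rceil>)" by linarith
    then have "r * ln 2 \<le> real (nat \<lceil>r\<rceil>) * ln 2" by (intro mult_right_mono) auto
    also have "\<dots> = ln (2 ^ nat \<lceil>r\<rceil>)" by (simp add: ln_realpow)
    also have "\<dots> \<le> ln (real n)" by (intro ln_mono) (simp_all add: n_def)
    finally show ?thesis by (simp add: f c_def)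
  qed
  moreover have "continuous_on {0..b} ?f"
  proof -
    have "exp \<epsilon> + c \<noteq> 0" for \<epsilon> using c exp_gt_zero[of \<epsilon>] by linarith
    then show ?thesis unfolding f by (intro continuous_intros) auto
  qed
  ultimately obtain \<epsilon> where "?f \<epsilon> = r * ln 2"
    using IVT2'[of ?f b "r * ln 2" 0] b by blast
  then have "shannon_entropy (U_min n \<epsilon> 1) = ennreal r"
    using n shannon_entropy_U_min[of 1 n \<epsilon>] by simp
  then show ?thesis by blast
qed

lemma exists_pmf_entropy: "\<exists>W :: nat pmf. shannon_entropy W = d"
  using exists_pmf_infinite_entropy exists_pmf_finite_entropy by (cases d) auto

section \<open>Laws with prescribed support and image\<close>

lemma exists_pmf_full_support:
  assumes "countable A" "A \<noteq> {}"
  shows "\<exists>p. set_pmf p = A"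
proof (intro exI)
  show "set_pmf (map_pmf (from_nat_into A) (geometric_pmf (1/2))) = A"
    using assms by (simp add: set_pmf_geometric range_from_nat_into)
qed

text \<open>Distribute the mass of each atom of \<open>\<mu>\<close> over its fiber under
  \<open>g\<close> by a law of full support. This enlarges a key set to \<open>A\<close> without
  changing the law that the encoder sees.\<close>

lemma exists_pmf_lift:
  assumes "countable A" "g ` A = set_pmf \<mu>"
  shows "\<exists>p. set_pmf p = A \<and> map_pmf g p = \<mu>"
proof -
  have "\<exists>p. set_pmf p = {a \<in> A. g a = b}" if "b \<in> set_pmf \<mu>" for b
  proof (rule exists_pmf_full_support)
    show "countable {a \<in> A. g a = b}" using assms(1) by (rule countable_subset[rotated]) auto
    have "b \<in> g ` A" using that assms(2) by simp
    then show "{a \<in> A. g a = b} \<noteq> {}" by auto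
  qed
  then obtain q where q: "\<And>b. b \<in> set_pmf \<mu> \<Longrightarrow> set_pmf (q b) = {a \<in> A. g a = b}" by metis
  have "set_pmf (bind_pmf \<mu> q) = A" using q assms(2) by auto
  moreover have "map_pmf g (bind_pmf \<mu> q) = bind_pmf \<mu> return_pmf"
    unfolding map_bind_pmf
  proof (rule bind_pmf_cong[OF refl])
    fix b assume "b \<in> set_pmf \<mu>"
    then have "map_pmf g (q b) = map_pmf (\<lambda>_. b) (q b)" using q by (intro map_pmf_cong) auto
    then show "map_pmf g (q b) = return_pmf b" by (simp add: map_pmf_const)
  qed
  ultimately show ?thesis by (metis bind_return_pmf')
qed

text \<open>A one-time pad on blocks: the block number \<open>j\<close> and the shift \<open>r\<close> form the key.\<close>

lemma block_shift_mechanism: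
  fixes X :: "'x set" and J :: "nat pmf" and A :: "nat set"
  assumes "1 \<le> T" "finite X" "X \<noteq> {}" "0 \<le> \<epsilon>"
    and L: "card (databases X T) \<le> L" and A: "set_pmf J \<times> {..<L} \<lesssim> A"
  shows "\<exists>(U :: nat pmf) (Y :: nat \<Rightarrow> nat set) enc. DP_Rec \<epsilon> X T U Y enc \<and>
    attained_outputs X T U Y enc = output_space T Y \<and>
    set_pmf U \<approx> A \<and> output_space T Y \<approx> set_pmf J \<times> {..<L}"
proof -
  let ?D = "databases X T" and ?B = "set_pmf J \<times> {..<L}"
  have D: "finite ?D" "?D \<noteq> {}"
    using finite_databases[OF \<open>finite X\<close>] databases_nonempty[OF \<open>X \<noteq> {}\<close>] .
  then have "0 < card ?D" by (simp add: card_gt_0_iff)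
  then have "0 < L" using L by linarith
  then have N: "{..<L} \<noteq> {}" "finite {..<L}" by (auto simp: lessThan_empty_iff)
  obtain s where bij: "\<And>x. x \<in> ?D \<Longrightarrow> bij_betw (s x) {..<L} {..<L}"
    and inj: "\<And>c. c < L \<Longrightarrow> inj_on (\<lambda>x. s x c) ?D"
    using cyclic_shifts_exist[OF D(1) L] by metis
  define \<mu> where "\<mu> = pair_pmf J (pmf_of_set {..<L})"
  have set_\<mu>: "set_pmf \<mu> = ?B" using N by (simp add: \<mu>_def)
  \<comment> \<open>A map from \<open>A\<close> that covers \<open>?B\<close> is made to take values
    in \<open>?B\<close> only, by sending stray elements to a default \<open>b\<close>.\<close>
  obtain g where g: "g ` A = ?B"
  proof -
    obtain f where f: "?B \<subseteq> f ` A" using A unfolding lepoll_iff by blast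
    obtain b where b: "b \<in> ?B"
      using set_pmf_not_empty[of \<mu>] unfolding set_\<mu> ex_in_conv[symmetric] ..
    have "(\<lambda>a. if f a \<in> ?B then f a else b) ` A = ?B" (is "?g ` A = _")
    proof (intro equalityI subsetI)
      fix z assume z: "z \<in> ?B"
      with f have "z \<in> f ` A" by (rule subsetD)
      then obtain a where a: "a \<in> A" "z = f a" by (rule imageE)
      have "z = ?g a" using z unfolding a(2) by (simp only: if_True)
      then show "z \<in> ?g ` A" using a(1) by (rule image_eqI)
    next
      fix z assume "z \<in> ?g ` A"
      then obtain a where "z = ?g a" by (rule imageE)
      then show "z \<in> ?B" using b by (cases "f a \<in> ?B") (simp_all only: if_True if_False)
    qed
    then show thesis by (rule that)
  qed
  obtain V where V: "set_pmf V = A" "map_pmf g V = \<mu>"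
    using exists_pmf_lift[of A g \<mu>] g set_\<mu> by auto
  define e where "e x v = apsnd (s x) (g v)" for x v
  \<comment> \<open>A bijective shift preserves the uniform law, so the output law is the same for
    all databases.\<close>
  have map_e: "map_pmf (e x) V = \<mu>" if "x \<in> ?D" for x
  proof -
    have "map_pmf (e x) V = map_pmf (apsnd (s x)) (map_pmf g V)"
      unfolding map_pmf_comp e_def ..
    also have "\<dots> = pair_pmf J (map_pmf (s x) (pmf_of_set {..<L}))"
      by (simp add: V(2) \<mu>_def pair_map_pmf2)
    also have "\<dots> = \<mu>"
      unfolding \<mu>_def map_pmf_of_set_bij_betw[OF bij[OF that] N] ..
    finally show ?thesis .
  qed
  have "\<exists>(U :: nat pmf) (Y :: nat \<Rightarrow> nat set) enc. DP_Rec \<epsilon> X T U Y enc \<and>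
    attained_outputs X T U Y enc = output_space T Y \<and>
    set_pmf U \<approx> set_pmf V \<and> output_space T Y \<approx> ?B \<and> shannon_entropy U = shannon_entropy V"
  proof (rule one_shot_mechanism[OF \<open>1 \<le> T\<close> \<open>X \<noteq> {}\<close>, where e = e])
    show "e x ` set_pmf V = ?B" if "x \<in> ?D" for x
      unfolding set_map_pmf[symmetric] map_e[OF that] set_\<mu> ..
    show "inj_on (\<lambda>x. e x v) ?D" if "v \<in> set_pmf V" for v
    proof -
      have "g v \<in> ?B" using that V(1) g by blast
      then have "inj_on (\<lambda>x. s x (snd (g v))) ?D" by (intro inj) auto
      then show ?thesis by (auto simp: e_def inj_on_def apsnd_def map_prod_def split: prod.splits)
    qed
    show "pmf (map_pmf (e x) V) y \<le> exp \<epsilon> * pmf (map_pmf (e x') V) y"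
      if "x \<in> ?D" "x' \<in> ?D" for x x' y
    proof -
      have "1 * pmf \<mu> y \<le> exp \<epsilon> * pmf \<mu> y"
        using \<open>0 \<le> \<epsilon>\<close> by (intro mult_right_mono) auto
      then show ?thesis by (simp only: map_e[OF that(1)] map_e[OF that(2)] mult_1)
    qed
  qed
  then show ?thesis unfolding V(1) by blast
qed

text \<open>A finite \<open>B\<close> is a single block. An infinite \<open>B\<close> is countable,
  hence equipollent to countably many blocks of size \<open>card D\<close>.\<close>

lemma block_decomposition:
  fixes B :: "nat set"
  assumes "finite D" "D \<noteq> {}" "D \<lesssim> B"
  shows "\<exists>(J :: nat pmf) L. card D \<le> L \<and> set_pmf J \<times> {..<L} \<approx> B"
proof (cases "finite B")
  case True
  have "card D \<le> card B" using assms True by (simp add: lepoll_iff_card_le)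
  moreover have "set_pmf (return_pmf (0 :: nat)) \<times> {..<card B} \<approx> B"
    using True by (simp add: eqpoll_iff_card card_cartesian_product)
  ultimately show ?thesis by blast
next
  case False
  have card: "0 < card D" using assms by (simp add: card_gt_0_iff)
  let ?S = "set_pmf (geometric_pmf (1/2)) \<times> {..<card D}"
  have inf: "infinite ?S"
  proof
    assume "finite ?S"
    then have "finite (fst ` ?S)" by (rule finite_imageI)
    moreover have "fst ` ?S = UNIV" using card by (force simp: set_pmf_geometric)
    ultimately show False by simp
  qed
  have "?S \<approx> (UNIV :: nat set)"
    unfolding eqpoll_def by (rule exI, rule to_nat_on_infinite[OF _ inf]) simp
  also have "B \<approx> (UNIV :: nat set)"
    unfolding eqpoll_def by (rule exI, rule to_nat_on_infinite[OF _ False]) simp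
  note eqpoll_sym[OF this]
  finally have "?S \<approx> B" .
  with order_refl show ?thesis by blast
qed

theorem theorem6:
  fixes X :: "'x set" and k T :: nat and \<epsilon> :: real and H\<^sub>0 :: ennreal
  assumes "finite X" and "card X = k" and "k \<ge> 1" and "T \<ge> 1" and "\<epsilon> \<ge> 0"
  assumes "H\<^sub>0 = of_nat T *
    (MIN s\<in>{nat \<lceil>s_opt k \<epsilon>\<rceil>, nat \<lfloor>s_opt k \<epsilon>\<rfloor>}. shannon_entropy (U_min k \<epsilon> s))"
  shows
    \<comment> \<open>both conditions are necessary\<close>
    "(\<forall>(U :: 'u pmf) (Y :: nat \<Rightarrow> 'y set) enc. DP_Rec \<epsilon> X T U Y enc \<longrightarrow>
        attained_outputs X T U Y enc \<lesssim> set_pmf U \<and>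
        databases X T \<lesssim> attained_outputs X T U Y enc \<and>
        shannon_entropy U \<ge> H\<^sub>0)
    \<and>
    \<comment> \<open>all sizes allowed by the first condition occur\<close>
     (\<forall>(A :: nat set) (B :: nat set). B \<lesssim> A \<and> databases X T \<lesssim> B \<longrightarrow>
        (\<exists>(U :: nat pmf) (Y :: nat \<Rightarrow> nat set) enc. DP_Rec \<epsilon> X T U Y enc \<and>
          attained_outputs X T U Y enc = output_space T Y \<and>
          set_pmf U \<approx> A \<and> output_space T Y \<approx> B))
    \<and>
    \<comment> \<open>all key entropies allowed by the second condition occur\<close>
     (\<forall>h :: ennreal. h \<ge> H\<^sub>0 \<longrightarrow>
        (\<exists>(U :: nat pmf) (Y :: nat \<Rightarrow> nat set) enc. DP_Rec \<epsilon> X T U Y enc \<and>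
          attained_outputs X T U Y enc = output_space T Y \<and>
          shannon_entropy U = h))
    \<and>
    \<comment> \<open>the least sizes and the least key entropy occur simultaneously\<close>
     (\<exists>(U :: nat pmf) (Y :: nat \<Rightarrow> nat set) enc. DP_Rec \<epsilon> X T U Y enc \<and>
        attained_outputs X T U Y enc = output_space T Y \<and>
        set_pmf U \<approx> databases X T \<and> output_space T Y \<approx> databases X T \<and>
        shannon_entropy U = H\<^sub>0)"
proof -
  have X: "X \<noteq> {}" "0 < k" using assms(2,3) by auto
  define a where "a = nat \<lceil>s_opt k \<epsilon>\<rceil>"
  define b where "b = nat \<lfloor>s_opt k \<epsilon>\<rfloor>"
  have ab: "a \<le> k" "b \<le> k"
    using s_opt_bounds[OF \<open>\<epsilon> \<ge> 0\<close>, of k] by (simp_all add: a_def b_def ceiling_le_iff) linarith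
  \<comment> \<open>\<open>s\<close> is whichever rounding of \<open>s_opt k \<epsilon>\<close>
    gives the smaller entropy.\<close>
  obtain s where s: "s \<in> {a, b}"
    and s_min: "two_level_entropy k \<epsilon> s
      = min (two_level_entropy k \<epsilon> a) (two_level_entropy k \<epsilon> b)"
    by (metis insertCI min_def)
  then have "s \<le> k" using ab by auto
  define h where "h = two_level_entropy k \<epsilon> s"
  have h: "h \<le> two_level_entropy k \<epsilon> (real i)" for i
    unfolding h_def s_min a_def b_def
    using two_level_entropy_integer_minimum[OF \<open>0 < k\<close> \<open>\<epsilon> \<ge> 0\<close>] .
  have Us: "shannon_entropy (U_min k \<epsilon> s) = ennreal (h / ln 2)"
    unfolding h_def using shannon_entropy_U_min[OF \<open>s \<le> k\<close> \<open>0 < k\<close>] .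
  have H0: "H\<^sub>0 = of_nat T * shannon_entropy (U_min k \<epsilon> s)"
  proof -
    have "ennreal (h / ln 2) \<le> shannon_entropy (U_min k \<epsilon> i)" if "i \<in> {a, b}" for i
      using shannon_entropy_U_min[of i k \<epsilon>] ab that h[of i] X
      by (auto intro!: ennreal_leI divide_right_mono)
    then have "(MIN i\<in>{a, b}. shannon_entropy (U_min k \<epsilon> i)) = shannon_entropy (U_min k \<epsilon> s)"
      unfolding Us[symmetric] using s by (intro Min_eqI) auto
    then show ?thesis unfolding assms(6) a_def b_def by simp
  qed
  have H0_ennreal: "H\<^sub>0 = ennreal (real T * (h / ln 2))"
    unfolding H0 Us ennreal_of_nat_eq_real_of_nat by (rule ennreal_mult'[symmetric]) simp
  define p where "p = U_min k \<epsilon> s"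
  have p: "set_pmf p = {..<card X}"
      "\<And>c d. c < card X \<Longrightarrow> d < card X \<Longrightarrow> pmf p c \<le> exp \<epsilon> * pmf p d"
  proof -
    define t where "t = real s * exp \<epsilon> + real k - real s"
    have t: "0 < t" unfolding t_def using \<open>s \<le> k\<close> \<open>0 < k\<close> by (rule U_min_norm_pos)
    note pmf = pmf_U_min[OF \<open>s \<le> k\<close> \<open>0 < k\<close>, of \<epsilon>, folded t_def]
    show "set_pmf p = {..<card X}"
      using t \<open>s \<le> k\<close> by (auto simp: p_def set_pmf_iff pmf assms(2) split: if_splits)
    have E: "1 \<le> exp \<epsilon>" using \<open>\<epsilon> \<ge> 0\<close> by simp
    have EE: "exp \<epsilon> * 1 \<le> exp \<epsilon> * exp \<epsilon>" using E by (intro mult_left_mono) auto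
    have E2: "1 \<le> exp \<epsilon> * exp \<epsilon>" using E EE by linarith
    show "pmf p c \<le> exp \<epsilon> * pmf p d" if "c < card X" "d < card X" for c d
      using that t E by (auto simp: p_def pmf assms(2) intro!: divide_right_mono E2)
  qed
  note iid = iid_shift_mechanism[OF \<open>T \<ge> 1\<close> \<open>finite X\<close> \<open>X \<noteq> {}\<close> p]
  show ?thesis
  proof (intro conjI allI impI)
    fix U :: "'u pmf" and Y :: "nat \<Rightarrow> 'y set" and enc
    assume DP: "DP_Rec \<epsilon> X T U Y enc"
    show "attained_outputs X T U Y enc \<lesssim> set_pmf U"
      using DP_Rec_attained_lepoll[OF DP X(1)] .
    show "databases X T \<lesssim> attained_outputs X T U Y enc"
      using DP_Rec_databases_lepoll[OF DP] .
    show "H\<^sub>0 \<le> shannon_entropy U"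
      unfolding H0_ennreal
      using DP_Rec_entropy_ge[OF DP \<open>finite X\<close> X(1) \<open>\<epsilon> \<ge> 0\<close>, of h] h assms(2) by simp
  next
    fix A B :: "nat set" assume AB: "B \<lesssim> A \<and> databases X T \<lesssim> B"
    obtain J :: "nat pmf" and L where J: "card (databases X T) \<le> L" "set_pmf J \<times> {..<L} \<approx> B"
      using block_decomposition[of "databases X T" B] AB
        finite_databases[OF \<open>finite X\<close>] databases_nonempty[OF X(1)] by blast
    have "set_pmf J \<times> {..<L} \<lesssim> A"
      using J(2) AB eqpoll_imp_lepoll lepoll_trans by blast
    from block_shift_mechanism[OF \<open>T \<ge> 1\<close> \<open>finite X\<close> X(1) \<open>\<epsilon> \<ge> 0\<close> J(1) this]
    show "\<exists>(U :: nat pmf) (Y :: nat \<Rightarrow> nat set) enc. DP_Rec \<epsilon> X T U Y enc \<and>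
        attained_outputs X T U Y enc = output_space T Y \<and> set_pmf U \<approx> A \<and> output_space T Y \<approx> B"
      using J(2) eqpoll_trans by blast
  next
    fix e :: ennreal assume e: "H\<^sub>0 \<le> e"
    \<comment> \<open>Subtraction in \<open>ennreal\<close> is truncated, but
      \<open>H\<^sub>0 \<le> e\<close> makes adding \<open>e - H\<^sub>0\<close> to
      \<open>H\<^sub>0\<close> give \<open>e\<close>, also for infinite \<open>e\<close>.\<close>
    obtain W :: "nat pmf" where "shannon_entropy W = e - H\<^sub>0"
      using exists_pmf_entropy by blast
    then have "of_nat T * shannon_entropy p + shannon_entropy W = e"
      using e by (simp add: p_def H0)
    with iid[of W] show "\<exists>(U :: nat pmf) (Y :: nat \<Rightarrow> nat set) enc. DP_Rec \<epsilon> X T U Y enc \<and>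
        attained_outputs X T U Y enc = output_space T Y \<and> shannon_entropy U = e"
      by auto
  next
    \<comment> \<open>A deterministic extra component adds neither keys nor entropy.\<close>
    have "databases X T \<times> set_pmf (return_pmf (0 :: nat)) \<approx> databases X T"
      by (metis set_return_pmf times_commute_eqpoll times_singleton_eqpoll eqpoll_trans)
    moreover obtain U :: "nat pmf" and Y :: "nat \<Rightarrow> nat set" and enc
      where U: "DP_Rec \<epsilon> X T U Y enc" "attained_outputs X T U Y enc = output_space T Y"
        "set_pmf U \<approx> databases X T \<times> set_pmf (return_pmf (0 :: nat))" "output_space T Y \<approx> databases X T"
        "shannon_entropy U = of_nat T * shannon_entropy p + shannon_entropy (return_pmf (0 :: nat))"
      using iid[of "return_pmf 0"] by blast
    ultimately have "set_pmf U \<approx> databases X T" using eqpoll_trans by blast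
    moreover have "shannon_entropy U = H\<^sub>0" using U(5) by (simp add: shannon_entropy_return p_def H0)
    ultimately show "\<exists>(U :: nat pmf) (Y :: nat \<Rightarrow> nat set) enc. DP_Rec \<epsilon> X T U Y enc \<and>
        attained_outputs X T U Y enc = output_space T Y \<and>
        set_pmf U \<approx> databases X T \<and> output_space T Y \<approx> databases X T \<and>
        shannon_entropy U = H\<^sub>0"
      using U(1,2,4) by blast
  qed
qed

end
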